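(* Let $W$ be a nonempty set of nonempty linear words. Then the semiring $S(W)$ is finitely based in the signature $(+,\cdot)$; that is, there is a finite set of identities in the signature $(+,\cdot)$, all valid in $S(W)$, from which every identity valid in $S(W)$ can be derived. (There is no restriction on the cardinality of $W$ or on the lengths of its words.)
   Context: For an alphabet $X$, $X^+$ is the free semigroup on $X$ (all nonempty finite words). For a nonempty set $W\subseteq X^+$, $F(W)$ denotes the set of all nonempty contiguous factors of words in $W$. The algebra $S(W)=(F(W)\cup\{0\},+,\cdot)$ has the following operations: addition is flat, i.e. $x+x=x$ and $x+y=0$ whenever $x\neq y$; for $u,v\in F(W)$, $u\cdot v$ is the concatenation $uv$ if $uv\in F(W)$ and $u\cdot v=0$ otherwise; products involving $0$ are $0$. (This is an additively idempotent semiring: $+$ is associative, commutative and idempotent, $\cdot$ is associative, and both distributive laws hold. No constants belong to the signature $(+,\cdot)$.) A word is linear if no letter occurs in it more than once. *)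

theory Defs
  imports Main "HOL-Library.Sublist"
begin

section \<open>Algebras, terms and identities in the signature with two binary operations\<close>

record 'b alg2 =
  carrier :: "'b set"
  add :: "'b \<Rightarrow> 'b \<Rightarrow> 'b"
  mult :: "'b \<Rightarrow> 'b \<Rightarrow> 'b"

text \<open>Variables are drawn from the countably infinite set of natural numbers.
  There are no constant symbols.\<close>

datatype trm = Var nat | Plus trm trm | Times trm trm

fun eval :: "('b, 'm) alg2_scheme \<Rightarrow> (nat \<Rightarrow> 'b) \<Rightarrow> trm \<Rightarrow> 'b" where
  "eval A \<rho> (Var x) = \<rho> x"
| "eval A \<rho> (Plus s t) = add A (eval A \<rho> s) (eval A \<rho> t)"
| "eval A \<rho> (Times s t) = mult A (eval A \<rho> s) (eval A \<rho> t)"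

fun subst :: "(nat \<Rightarrow> trm) \<Rightarrow> trm \<Rightarrow> trm" where
  "subst \<sigma> (Var x) = \<sigma> x"
| "subst \<sigma> (Plus s t) = Plus (subst \<sigma> s) (subst \<sigma> t)"
| "subst \<sigma> (Times s t) = Times (subst \<sigma> s) (subst \<sigma> t)"

text \<open>The pair \<open>(s, t)\<close> stands for the identity \<open>s \<approx> t\<close>.\<close>

type_synonym identity = "trm \<times> trm"

definition valid :: "('b, 'm) alg2_scheme \<Rightarrow> identity \<Rightarrow> bool" where
  "valid A e \<longleftrightarrow>
     (\<forall>\<rho>. (\<forall>x. \<rho> x \<in> carrier A) \<longrightarrow> eval A \<rho> (fst e) = eval A \<rho> (snd e))"

text \<open>Derivability in Birkhoff's equational logic. The semiring axioms are not built in.\<close>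

inductive derivable :: "identity set \<Rightarrow> trm \<Rightarrow> trm \<Rightarrow> bool" for E where
  ax: "(s, t) \<in> E \<Longrightarrow> derivable E (subst \<sigma> s) (subst \<sigma> t)"
| refl: "derivable E s s"
| sym: "derivable E s t \<Longrightarrow> derivable E t s"
| trans: "derivable E s t \<Longrightarrow> derivable E t u \<Longrightarrow> derivable E s u"
| plus: "derivable E s s' \<Longrightarrow> derivable E t t' \<Longrightarrow> derivable E (Plus s t) (Plus s' t')"
| times: "derivable E s s' \<Longrightarrow> derivable E t t' \<Longrightarrow> derivable E (Times s t) (Times s' t')"

definition finitely_based :: "('b, 'm) alg2_scheme \<Rightarrow> bool" where
  "finitely_based A \<longleftrightarrow>
     (\<exists>E. finite E \<and> (\<forall>e\<in>E. valid A e) \<and> (\<forall>s t. valid A (s, t) \<longrightarrow> derivable E s t))"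

section \<open>The semiring of a set of words\<close>

text \<open>Words over the alphabet \<open>'a\<close> are lists; \<^const>\<open>sublist\<close> means contiguous factor.\<close>

definition factors :: "'a list set \<Rightarrow> 'a list set" where
  "factors W = {u. u \<noteq> [] \<and> (\<exists>w\<in>W. sublist u w)}"

text \<open>The element \<open>0\<close> is \<^const>\<open>None\<close>, and a word \<open>u\<close> is represented by \<open>Some u\<close>.\<close>

definition flat_add :: "'b option \<Rightarrow> 'b option \<Rightarrow> 'b option" where
  "flat_add x y = (if x = y then x else None)"

fun word_mult :: "'a list set \<Rightarrow> 'a list option \<Rightarrow> 'a list option \<Rightarrow> 'a list option" where
  "word_mult W (Some u) (Some v) = (if u @ v \<in> factors W then Some (u @ v) else None)"
| "word_mult W None y = None"
| "word_mult W x None = None"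

definition word_semiring :: "'a list set \<Rightarrow> 'a list option alg2" where
  "word_semiring W =
     \<lparr>carrier = insert None (Some ` factors W), add = flat_add, mult = word_mult W\<rparr>"

lemma word_semiring_closed:
  assumes "x \<in> carrier (word_semiring W)" "y \<in> carrier (word_semiring W)"
  shows "flat_add x y \<in> carrier (word_semiring W)"
    and "word_mult W x y \<in> carrier (word_semiring W)"
  using assms by (auto simp: word_semiring_def flat_add_def)

lemma factors_append:
  assumes "u @ v \<in> factors W"
  shows "u \<noteq> [] \<Longrightarrow> u \<in> factors W" "v \<noteq> [] \<Longrightarrow> v \<in> factors W"
  using assms unfolding factors_def
  by (auto simp: sublist_def) (metis append.assoc)+

lemma flat_add_semilattice:
  "flat_add x x = x"
  "flat_add x y = flat_add y x"
  "flat_add (flat_add x y) z = flat_add x (flat_add y z)"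
  by (auto simp: flat_add_def)

lemma word_mult_distrib:
  "word_mult W x (flat_add y z) = flat_add (word_mult W x y) (word_mult W x z)"
  "word_mult W (flat_add x y) z = flat_add (word_mult W x z) (word_mult W y z)"
  by (cases x; cases y; cases z; auto simp: flat_add_def)+

lemma word_mult_assoc:
  assumes "x \<in> carrier (word_semiring W)" "z \<in> carrier (word_semiring W)"
  shows "word_mult W (word_mult W x y) z = word_mult W x (word_mult W y z)"
  using assms factors_append[of "the x @ the y" "the z" W]
    factors_append[of "the x" "the y @ the z" W]
  by (cases x; cases y; cases z) (auto simp: word_semiring_def factors_def)

end

theory Submission
  imports Defs
begin

text \<open>For a term \<open>t\<close> let \<open>P\<close> be the set of words \<open>u\<close> for which \<open>t + u \<approx> t\<close> is derivable. Unless \<open>t \<approx> 0\<close> is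
  derivable, the basis makes \<open>P\<close> a finite language of linear words whose residual languages are
  pairwise equal or disjoint, so they are the vertices of an acyclic digraph in which every letter
  labels a single edge and \<open>P\<close> consists of the paths from source to sink. Numbering the
  vertices compatibly with the edges cuts a linear word into segments, one for each letter, and so
  gives an assignment under which \<open>t\<close> is nonzero. A word \<open>u\<close> outside \<open>P\<close> leaves the digraph at some
  vertex, and a numbering that separates two suitable vertices refutes \<open>t + u \<approx> t\<close>. If the
  lengths of the words in \<open>W\<close> are bounded by \<open>m\<close>, two vertices at the same distance from the source
  cannot be separated when both lie on paths of length \<open>m\<close>; the cross identities identify these.\<close>

section \<open>Closed languages and their labellings\<close>

text \<open>\<open>P\<close> is a set of words in the variables, \<open>lens\<close> the set of
  lengths available for their common value. The premise on \<open>Suc (length u)\<close> in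
  \<open>cross\<close> singles out words whose values cannot be longer than the words
  themselves.\<close>

locale closed_language =
  fixes P :: "'b list set" and lens :: "nat set"
  assumes finite_P: "finite P"
    and P_nonempty: "P \<noteq> {}"
    and Nil_notin_P: "[] \<notin> P"
    and splice: "p @ x # q \<in> P \<Longrightarrow> p' @ x # q' \<in> P \<Longrightarrow> p @ x # q' \<in> P"
    and suffix_free: "u \<in> P \<Longrightarrow> p @ u \<in> P \<Longrightarrow> p = []"
    and prefix_free: "u \<in> P \<Longrightarrow> u @ q \<in> P \<Longrightarrow> q = []"
    and rectangle: "p @ q \<in> P \<Longrightarrow> p @ q' \<in> P \<Longrightarrow> p' @ q \<in> P \<Longrightarrow> p' @ q' \<in> P"
    and length_lens: "u \<in> P \<Longrightarrow> length u \<in> lens"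
    and cross: "u \<in> P \<Longrightarrow> v \<in> P \<Longrightarrow> length u = length v \<Longrightarrow> Suc (length u) \<notin> lens \<Longrightarrow>
      take i u @ drop i v \<in> P"
begin

section \<open>Residual languages as vertices of a digraph\<close>

definition res :: "'b list \<Rightarrow> 'b list set" where
  "res p = {q. p @ q \<in> P}"

lemma res_Nil: "res [] = P"
  by (simp add: res_def)

text \<open>\<open>rectangle\<close> carries every continuation of one prefix over to the other as
  soon as they share one. Distinct residuals are thus disjoint.\<close>

lemma res_eqI:
  assumes "q \<in> res p" "q \<in> res p'"
  shows "res p = res p'"
  using assms rectangle[of p q _ p'] rectangle[of p' q _ p] unfolding res_def by blast

lemma res_append: "res p = res p' \<Longrightarrow> res (p @ r) = res (p' @ r)"
  by (auto simp: res_def set_eq_iff)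

lemma res_final: "u \<in> P \<Longrightarrow> res u = {[]}"
  using prefix_free by (auto simp: res_def)

lemma final_iff: "p \<in> P \<longleftrightarrow> [] \<in> res p"
  by (simp add: res_def)

lemma res_initial: "res p = P \<Longrightarrow> p = []"
  using P_nonempty suffix_free by (auto simp: res_def)

text \<open>By \<open>splice\<close> both residuals contain \<open>x # q'\<close>. All edges
  labelled \<open>x\<close> therefore leave the same vertex.\<close>

lemma res_letter: "p @ x # q \<in> P \<Longrightarrow> p' @ x # q' \<in> P \<Longrightarrow> res p = res p'"
  using splice[of p x q p' q'] by (intro res_eqI[of "x # q'"]) (auto simp: res_def)

text \<open>One fixed continuation completes every member of the class to a word of
  \<open>P\<close>, so the class consists of prefixes of finitely many words.\<close>

lemma finite_res_class: "res p \<noteq> {} \<Longrightarrow> finite {p'. res p' = res p}"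
proof (rule finite_subset)
  assume "res p \<noteq> {}"
  then obtain q where "q \<in> res p" by blast
  then have "q \<in> res p'" if "res p' = res p" for p' using that by simp
  then have "p' @ q \<in> P" if "res p' = res p" for p' using that unfolding res_def by blast
  moreover have "p' \<in> set (prefixes (p' @ q))" for p' by simp
  ultimately show "{p'. res p' = res p} \<subseteq> (\<Union>u\<in>P. set (prefixes u))" by blast
qed (use finite_P in simp)

text \<open>Residual languages are the cut points common to the words of \<open>P\<close>. The height of a residual is
  the length of the longest word leading to it, where passing through the cut point \<open>Z\<close> counts
  one extra step.\<close>

definition weight :: "'b list set \<Rightarrow> 'b list \<Rightarrow> nat" where
  "weight Z p = length p + (if \<exists>p'. prefix p' p \<and> res p' = Z then 1 else 0)"

definition height :: "'b list set \<Rightarrow> 'b list \<Rightarrow> nat" where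
  "height Z p = Max (weight Z ` {p'. res p' = res p})"

text \<open>The sink is moved to \<open>N\<close>, which may exceed its height.\<close>

definition pos :: "'b list set \<Rightarrow> nat \<Rightarrow> 'b list \<Rightarrow> nat" where
  "pos Z N p = (if p \<in> P then N else height Z p)"

text \<open>\<open>Z \<noteq> P\<close> keeps the source at 0; the bound on the weights leaves room
  for the sink at \<open>N\<close>.\<close>

definition admissible :: "'b list set \<Rightarrow> nat \<Rightarrow> bool" where
  "admissible Z N \<longleftrightarrow> N \<in> lens \<and> Z \<noteq> P \<and> (\<forall>u\<in>P. weight Z u \<le> N)"

text \<open>The last clause makes \<open>f\<close> a function of the vertex; prefixes that no word
  of \<open>P\<close> extends are unconstrained.\<close>

definition labelling :: "('b list \<Rightarrow> nat) \<Rightarrow> nat \<Rightarrow> bool" where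
  "labelling f N \<longleftrightarrow> N \<in> lens \<and> f [] = 0 \<and> (\<forall>u\<in>P. f u = N) \<and>
     (\<forall>p x q. p @ x # q \<in> P \<longrightarrow> f p < f (p @ [x])) \<and>
     (\<forall>p p'. res p \<noteq> {} \<longrightarrow> res p = res p' \<longrightarrow> f p = f p')"

lemma
  assumes "labelling f N"
  shows labelling_lens: "N \<in> lens"
    and labelling_Nil: "f [] = 0"
    and labelling_final: "u \<in> P \<Longrightarrow> f u = N"
    and labelling_step: "p @ x # q \<in> P \<Longrightarrow> f p < f (p @ [x])"
    and labelling_cong: "res p \<noteq> {} \<Longrightarrow> res p = res p' \<Longrightarrow> f p = f p'"
  using assms unfolding labelling_def by blast+

lemma weight_snoc: "Suc (weight Z p) \<le> weight Z (p @ [x])"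
  by (auto simp: weight_def)

lemma weight_le_height: "res p \<noteq> {} \<Longrightarrow> res p' = res p \<Longrightarrow> weight Z p' \<le> height Z p"
  unfolding height_def using finite_res_class by (intro Max_ge) auto

lemma height_attained:
  assumes "res p \<noteq> {}"
  obtains p' where "res p' = res p" "weight Z p' = height Z p"
proof -
  have "height Z p \<in> weight Z ` {p'. res p' = res p}"
    unfolding height_def using finite_res_class[OF assms] by (intro Max_in) auto
  then show ?thesis using that by auto
qed

text \<open>A longest path to the start of an edge, followed by that edge, is a path to its end, so
  numbering by longest paths grows strictly.\<close>

lemma labelling_pos:
  assumes "admissible Z N"
  shows "labelling (pos Z N) N"
  unfolding labelling_def
proof (intro conjI allI impI ballI)
  show "N \<in> lens" using assms by (simp add: admissible_def)
  have "{p'. res p' = res []} = {[]}" using res_initial res_Nil by auto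
  moreover have "weight Z [] = 0" using assms by (auto simp: weight_def admissible_def res_Nil)
  ultimately show "pos Z N [] = 0" by (simp add: pos_def height_def Nil_notin_P)
next
  fix p x q assume pxq: "p @ x # q \<in> P"
  then have ne: "res p \<noteq> {}" "res (p @ [x]) \<noteq> {}" by (auto simp: res_def)
  have "p \<notin> P" using prefix_free[of p "x # q"] pxq by auto
  obtain p' where p': "res p' = res p" "weight Z p' = height Z p"
    using height_attained[OF ne(1)] .
  have step: "Suc (height Z p) \<le> weight Z (p' @ [x])"
    using weight_snoc[of Z p' x] p' by simp
  show "pos Z N p < pos Z N (p @ [x])"
  proof (cases "p @ [x] \<in> P")
    case True
    then have "p' @ [x] \<in> P" using p' by (auto simp: res_def set_eq_iff)
    then have "weight Z (p' @ [x]) \<le> N" using assms by (simp add: admissible_def)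
    then show ?thesis using step True \<open>p \<notin> P\<close> by (simp add: pos_def)
  next
    case False
    have "weight Z (p' @ [x]) \<le> height Z (p @ [x])"
      using ne(2) res_append[OF p'(1)] by (rule weight_le_height)
    then show ?thesis using step False \<open>p \<notin> P\<close> by (simp add: pos_def)
  qed
next
  fix p p' assume "res p = res p'"
  then show "pos Z N p = pos Z N p'" by (simp add: pos_def height_def final_iff)
qed (auto simp: pos_def)

lemma weight_empty: "u \<in> P \<Longrightarrow> weight {} u = length u"
  by (auto simp: weight_def res_def prefix_def)

lemma prefix_res_nonempty: "res p \<noteq> {} \<Longrightarrow> prefix p' p \<Longrightarrow> res p' \<noteq> {}"
  by (auto simp: res_def prefix_def)

text \<open>\<open>{}\<close> plays the part of an absent cut point: prefixes of a word with
  nonempty residual have nonempty residuals too.\<close>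

lemma weight_empty_prefix: "res p \<noteq> {} \<Longrightarrow> weight {} p = length p"
  using prefix_res_nonempty by (auto simp: weight_def)

section \<open>Longest words and the separation of vertices\<close>

definition max_length :: nat where
  "max_length = Max (length ` P)"

lemma length_le_max: "u \<in> P \<Longrightarrow> length u \<le> max_length"
  unfolding max_length_def using finite_P by auto

lemma max_length_attained: "\<exists>u\<in>P. length u = max_length"
proof -
  have "max_length \<in> length ` P"
    unfolding max_length_def using finite_P P_nonempty by (intro Max_in) auto
  then show ?thesis by auto
qed

lemma admissible_plain: "admissible {} max_length"
proof -
  have "max_length \<in> lens" using max_length_attained length_lens by metis
  then show ?thesis using length_le_max P_nonempty by (auto simp: admissible_def weight_empty)
qed

lemma exists_labelling: "\<exists>f N. labelling f N"
  using labelling_pos[OF admissible_plain] by blast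

text \<open>No path to \<open>p'\<close> runs through the vertex of \<open>p\<close>, since a
  longest path to \<open>p\<close> would then extend to a path to \<open>p'\<close> exceeding their
  common height. The extra step at \<open>res p\<close> hence raises \<open>p\<close> but not
  \<open>p'\<close>.\<close>

lemma height_raised:
  assumes "res p \<noteq> {}" "res p' \<noteq> {}" "res p \<noteq> res p'" "height {} p = height {} p'"
  shows "height (res p) p \<noteq> height (res p) p'"
proof -
  obtain a where a: "res a = res p" "weight {} a = height {} p"
    using height_attained[OF assms(1)] .
  have "weight (res p) a = Suc (length a)" using a(1) by (auto simp: weight_def)
  then have "Suc (height {} p) \<le> height (res p) p"
    using weight_le_height[OF assms(1) a(1), of "res p"] a weight_empty_prefix[of a] assms(1)
    by simp
  moreover obtain b where b: "res b = res p'" "weight (res p) b = height (res p) p'"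
    using height_attained[OF assms(2)] .
  have "\<not> (\<exists>c. prefix c b \<and> res c = res p)"
  proof
    assume "\<exists>c. prefix c b \<and> res c = res p"
    then obtain c d where c: "b = c @ d" "res c = res p" by (auto simp: prefix_def)
    then have "d \<noteq> []" using b(1) assms(3) by auto
    \<comment> \<open>The initial part \<open>c\<close> of \<open>b\<close> is replaced by the
      longest path \<open>a\<close> to the same vertex.\<close>
    have "res (a @ d) = res p'" using res_append[of a c d] a c b by simp
    then have "weight {} (a @ d) \<le> height {} p'" by (intro weight_le_height assms(2))
    moreover have "weight {} (a @ d) = length a + length d"
      using weight_empty_prefix[of "a @ d"] assms(2) \<open>res (a @ d) = res p'\<close> by simp
    ultimately show False
      using a weight_empty_prefix[of a] assms(1,4) \<open>d \<noteq> []\<close> by (cases d) auto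
  qed
  then have "weight (res p) b = length b" by (simp add: weight_def)
  also have "\<dots> = weight {} b" using weight_empty_prefix[of b] b(1) assms(2) by simp
  also have "\<dots> \<le> height {} p'" using weight_le_height[OF assms(2) b(1)] .
  finally show ?thesis using \<open>Suc (height {} p) \<le> height (res p) p\<close> b(2) assms(4) by simp
qed

definition critical :: "'b list \<Rightarrow> bool" where
  "critical p \<longleftrightarrow> (\<exists>a b. a @ b \<in> P \<and> res a = res p \<and> length (a @ b) = max_length)"

text \<open>A longer path to this vertex, continued by \<open>b\<close>, would exceed
  \<open>max_length\<close>. Critical vertices of equal height thus cut longest words at the same
  position.\<close>

lemma critical_height:
  assumes "a @ b \<in> P" "res a = res p" "length (a @ b) = max_length"
  shows "length a = height {} p"
proof (rule antisym)
  have ne: "res p \<noteq> {}" using assms(1,2) by (auto simp: res_def)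
  then show "length a \<le> height {} p"
    using weight_le_height[OF ne assms(2), of "{}"] weight_empty_prefix[of a] assms(2) by simp
  obtain c where c: "res c = res p" "weight {} c = height {} p"
    using height_attained[OF ne] .
  have "c @ b \<in> P" using c assms by (auto simp: res_def set_eq_iff)
  then have "length (c @ b) \<le> max_length" by (rule length_le_max)
  then show "height {} p \<le> length a"
    using c weight_empty_prefix[of c] ne assms(3) by simp
qed

text \<open>Either \<open>lens\<close> has room for one more step, or every word through the vertex
  is shorter than \<open>max_length\<close> and the extra step fits.\<close>

lemma admissible_raised:
  assumes "res p \<noteq> P" "Suc max_length \<in> lens \<or> \<not> critical p"
  shows "\<exists>N. admissible (res p) N"
proof (cases "Suc max_length \<in> lens")
  case True
  then show ?thesis using assms(1) length_le_max
    by (intro exI[of _ "Suc max_length"]) (auto simp: admissible_def weight_def le_SucI)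
next
  case False
  then have nc: "\<not> critical p" using assms(2) by simp
  have "weight (res p) u \<le> max_length" if u: "u \<in> P" for u
  proof (cases "\<exists>c. prefix c u \<and> res c = res p")
    case True
    then obtain c d where "u = c @ d" "res c = res p" by (auto simp: prefix_def)
    then have "length u \<noteq> max_length" using nc u unfolding critical_def by blast
    then show ?thesis using length_le_max[OF u] by (auto simp: weight_def)
  next
    case False
    then show ?thesis using length_le_max[OF u] by (auto simp: weight_def)
  qed
  moreover have "max_length \<in> lens" using max_length_attained length_lens by metis
  ultimately show ?thesis using assms(1) unfolding admissible_def by blast
qed

text \<open>If the plain numbering does not separate the vertices, one of them is raised. This can
  fail only if both are critical and \<open>Suc max_length\<close> is missing from
  \<open>lens\<close>; then \<open>cross\<close> makes the residuals equal.\<close>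

lemma separating_labelling:
  assumes "res p \<noteq> {}" "res p' \<noteq> {}" "res p \<noteq> res p'"
  shows "\<exists>f N. labelling f N \<and> f p \<noteq> f p'"
proof (cases "pos {} max_length p = pos {} max_length p'")
  case False
  then show ?thesis using labelling_pos[OF admissible_plain] by blast
next
  case True
  have lab: "labelling (pos {} max_length) max_length"
    by (rule labelling_pos[OF admissible_plain])
  \<comment> \<open>The sink has number \<open>max_length\<close>; any other vertex has a nonempty
    continuation, hence a smaller height.\<close>
  have notfinal: "a \<notin> P"
    if hyp: "res a \<noteq> {}" "res b \<noteq> {}" "res a \<noteq> res b"
      "pos {} max_length a = pos {} max_length b" for a b
  proof
    assume "a \<in> P"
    then have "b \<notin> P" using res_final hyp(3) by auto
    obtain x q where "b @ x # q \<in> P"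
      using hyp(2) \<open>b \<notin> P\<close> by (auto simp: res_def) (metis append_Nil2 neq_Nil_conv)
    obtain c where c: "res c = res b" "weight {} c = height {} b"
      using height_attained[OF hyp(2)] .
    have "c @ x # q \<in> P" using c \<open>b @ x # q \<in> P\<close> by (auto simp: res_def set_eq_iff)
    then have "length c < max_length" using length_le_max by fastforce
    then show False
      using c weight_empty_prefix[of c] hyp \<open>a \<in> P\<close> \<open>b \<notin> P\<close> by (simp add: pos_def)
  qed
  \<comment> \<open>Only the source has height 0.\<close>
  have notinitial: "res a \<noteq> P"
    if hyp: "res a \<noteq> {}" "res b \<noteq> {}" "res a \<noteq> res b"
      "pos {} max_length a = pos {} max_length b" for a b
  proof
    assume "res a = P"
    then have "a = []" by (rule res_initial)
    then have "pos {} max_length b = 0" using labelling_Nil[OF lab] hyp(4) \<open>a = []\<close> by simp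
    moreover have "b \<notin> P" using notfinal[of b a] hyp by simp
    ultimately have "height {} b = 0" by (simp add: pos_def)
    then have "length b = 0"
      using weight_le_height[OF hyp(2) HOL.refl, of "{}"] by (simp add: weight_def)
    then show False using hyp(3) \<open>a = []\<close> by simp
  qed
  have fin: "p \<notin> P" "p' \<notin> P" and ini: "res p \<noteq> P" "res p' \<noteq> P"
    using notfinal[of p p'] notfinal[of p' p] notinitial[of p p'] notinitial[of p' p] assms True
    by auto
  have same: "height {} p = height {} p'" using True fin by (simp add: pos_def)
  \<comment> \<open>The situation is symmetric in \<open>p\<close> and \<open>p'\<close>;
    \<open>a\<close> is whichever of them can be raised.\<close>
  have raise: ?thesis
    if r: "Suc max_length \<in> lens \<or> \<not> critical a" and ab: "{a, b} = {p, p'}" for a b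
  proof -
    have ab': "res a \<noteq> {}" "res b \<noteq> {}" "res a \<noteq> res b" "height {} a = height {} b"
      "a \<notin> P" "b \<notin> P" "res a \<noteq> P"
      using ab assms same fin ini by (auto simp: doubleton_eq_iff)
    obtain N where "admissible (res a) N" using admissible_raised[OF ab'(7) r] by blast
    then have "labelling (pos (res a) N) N" by (rule labelling_pos)
    moreover have "pos (res a) N a \<noteq> pos (res a) N b"
      using height_raised[OF ab'(1-4)] ab' by (simp add: pos_def)
    ultimately show ?thesis using ab by (auto simp: doubleton_eq_iff)
  qed
  show ?thesis
  proof (cases "Suc max_length \<in> lens \<or> \<not> critical p \<or> \<not> critical p'")
    case True
    then show ?thesis using raise[of p p'] raise[of p' p] by (auto simp: insert_commute)
  next
    case False
    then obtain a b c d where ab: "a @ b \<in> P" "res a = res p" "length (a @ b) = max_length"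
      and cd: "c @ d \<in> P" "res c = res p'" "length (c @ d) = max_length"
      unfolding critical_def by metis
    have "length a = length c"
      using critical_height[OF ab] critical_height[OF cd] same by simp
    \<comment> \<open>Both words are longest and are cut at the same position, so
      \<open>cross\<close> joins the beginning of one to the end of the other.\<close>
    then have "a @ d \<in> P"
      using cross[OF ab(1) cd(1), of "length a"] ab cd False by simp
    then have "res a = res c" using cd by (intro res_eqI[of d]) (auto simp: res_def)
    then show ?thesis using ab cd assms by simp
  qed
qed

text \<open>A labelling cuts a word \<open>w\<close> of length \<open>N\<close> into one segment for each letter.\<close>

definition segment :: "('b list \<Rightarrow> nat) \<Rightarrow> 'c list \<Rightarrow> 'b \<Rightarrow> 'c list" where
  "segment f w x = (let p = (SOME p. \<exists>q. p @ x # q \<in> P)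
     in take (f (p @ [x]) - f p) (drop (f p) w))"

text \<open>All occurrences of \<open>x\<close> start at one vertex by \<open>res_letter\<close>,
  and a labelling depends on the vertex only, so the prefix chosen in \<open>segment\<close> is
  immaterial.\<close>

lemma segment_eq:
  assumes "labelling f N" "p @ x # q \<in> P"
  shows "segment f w x = take (f (p @ [x]) - f p) (drop (f p) w)"
proof -
  define p' where "p' = (SOME p. \<exists>q. p @ x # q \<in> P)"
  have "\<exists>q. p' @ x # q \<in> P"
    unfolding p'_def by (rule someI[of _ p]) (use assms in blast)
  then have res: "res p' = res p" using res_letter assms(2) by blast
  have ne: "res p \<noteq> {}" "res (p @ [x]) \<noteq> {}" using assms(2) by (auto simp: res_def)
  have "f p' = f p" "f (p' @ [x]) = f (p @ [x])"
    using labelling_cong[OF assms(1) ne(1) res[symmetric]]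
      labelling_cong[OF assms(1) ne(2) res_append[OF res, symmetric]] by auto
  then show ?thesis by (simp add: segment_def p'_def[symmetric])
qed

lemma label_le: "labelling f N \<Longrightarrow> p @ q \<in> P \<Longrightarrow> f p + length q \<le> N"
proof (induction q arbitrary: p)
  case Nil
  then show ?case using labelling_final[of f N p] by simp
next
  case (Cons x q)
  have "f p < f (p @ [x])" using Cons.prems by (rule labelling_step)
  moreover have "f (p @ [x]) + length q \<le> N" using Cons.IH[of "p @ [x]"] Cons.prems by simp
  ultimately show ?case by simp
qed

lemma segment_nonempty:
  assumes "labelling f N" "length w = N" "p @ x # q \<in> P"
  shows "segment f w x \<noteq> []"
  using label_le[OF assms(1,3)] assms(2) segment_eq[OF assms(1,3), of w]
    labelling_step[OF assms(1,3)]
  by auto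

text \<open>The segments telescope: each begins where the preceding one ends.\<close>

lemma concat_segments:
  assumes "labelling f N" "length w = N" "p @ q \<in> P"
  shows "concat (map (segment f w) p) = take (f p) w"
  using assms(3)
proof (induction p arbitrary: q rule: rev_induct)
  case Nil
  show ?case using labelling_Nil[OF assms(1)] by simp
next
  case (snoc x p)
  then have *: "p @ x # q \<in> P" by simp
  have "f p < f (p @ [x])" using assms(1) * by (rule labelling_step)
  then have "f (p @ [x]) = f p + (f (p @ [x]) - f p)" by simp
  then show ?case
    using snoc.IH[OF *] segment_eq[OF assms(1) *, of w] take_add[of "f p" "f (p @ [x]) - f p" w]
    by simp
qed

lemma concat_segments_word:
  "labelling f N \<Longrightarrow> length w = N \<Longrightarrow> u \<in> P \<Longrightarrow> concat (map (segment f w) u) = w"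
  using concat_segments[of f N w u "[]"] labelling_final[of f N u] by simp

section \<open>Refutation of words outside the language\<close>

lemma leaving_point:
  "(\<exists>q. u @ q \<in> P) \<or> (\<exists>p x r q. u = p @ x # r \<and> p @ q \<in> P \<and> res (p @ [x]) = {})"
proof (induction u rule: rev_induct)
  case Nil
  show ?case using P_nonempty by auto
next
  case (snoc x u)
  consider q where "u @ q \<in> P"
    | p y r q where "u = p @ y # r" "p @ q \<in> P" "res (p @ [y]) = {}"
    using snoc.IH by blast
  then show ?case
  proof cases
    case 1
    show ?thesis
    proof (cases "res (u @ [x]) = {}")
      case True
      then show ?thesis using 1 by blast
    next
      case False
      then show ?thesis unfolding res_def by blast
    qed
  next
    case 2
    then have "u @ [x] = p @ y # (r @ [x])" by simp
    then show ?thesis using 2 by blast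
  qed
qed

text \<open>A proper prefix of a word of \<open>P\<close> covers only an initial part of
  \<open>w\<close>. Otherwise \<open>u\<close> leaves the digraph by a letter \<open>x\<close> whose
  edge starts at another vertex; a labelling separating the two vertices puts the segment of
  \<open>x\<close> in the wrong place. On letters foreign to \<open>P\<close> the value of
  \<open>segment\<close> is arbitrary, so they are excluded here.\<close>

lemma refuting_labelling:
  assumes "u \<notin> P" "set u \<subseteq> \<Union> (set ` P)"
  shows "\<exists>f N. labelling f N \<and>
    (\<forall>w :: 'c list. length w = N \<longrightarrow> distinct w \<longrightarrow> concat (map (segment f w) u) \<noteq> w)"
  using leaving_point[of u]
proof (elim disjE exE conjE)
  fix q assume q: "u @ q \<in> P"
  then have "q \<noteq> []" using assms(1) by auto
  obtain f N where f: "labelling f N" using exists_labelling by blast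
  have "concat (map (segment f w) u) \<noteq> w" if "length w = N" for w :: "'c list"
  proof
    assume "concat (map (segment f w) u) = w"
    then have "take (f u) w = w" using concat_segments[OF f that q] by simp
    then have "length w \<le> f u" by simp
    then show False using label_le[OF f q] that \<open>q \<noteq> []\<close> by (cases q) auto
  qed
  then show ?thesis using f by blast
next
  fix p x r q
  assume u: "u = p @ x # r" and pq: "p @ q \<in> P" and dead: "res (p @ [x]) = {}"
  obtain p' q' where p': "p' @ x # q' \<in> P"
    using assms(2) u by (auto dest!: split_list)
  have "q \<in> res p" "x # q' \<in> res p'" using pq p' by (simp_all add: res_def)
  moreover have "x # q' \<notin> res p"
  proof
    assume "x # q' \<in> res p"
    then have "q' \<in> res (p @ [x])" by (simp add: res_def)
    then show False using dead by simp
  qed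
  ultimately have "res p \<noteq> {}" "res p' \<noteq> {}" "res p \<noteq> res p'" by auto
  from separating_labelling[OF this]
  obtain f N where f: "labelling f N" "f p \<noteq> f p'" by auto
  have "concat (map (segment f w) u) \<noteq> w" if w: "length w = N" "distinct w" for w :: "'c list"
  proof
    assume "concat (map (segment f w) u) = w"
    then have "take (f p) w @ segment f w x @ concat (map (segment f w) r) = w"
      using concat_segments[OF f(1) w(1) pq] by (simp add: u)
    \<comment> \<open>The first letter \<open>y\<close> of the segment would stand at position
      \<open>f p\<close> of \<open>w\<close>, but it was cut out at position \<open>f p'\<close>; in
      a linear word these must agree.\<close>
    moreover obtain y s where y: "segment f w x = y # s"
      using segment_nonempty[OF f(1) w(1) p'] by (cases "segment f w x") auto
    ultimately have ws: "w = take (f p) w @ y # s @ concat (map (segment f w) r)" by simp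
    have "f p \<le> N" "f p' < N" using label_le[OF f(1) pq] label_le[OF f(1) p'] by auto
    have "length (take (f p) w) = f p" using \<open>f p \<le> N\<close> w by simp
    moreover have nth: "v ! length a = y \<and> length a < length v"
      if "v = a @ y # b" for a b v :: "'c list"
      using that by simp
    ultimately have "w ! f p = y" "f p < length w" using nth[OF ws] by simp_all
    moreover have "w ! f p' = y"
    proof -
      have "drop (f p') w = w ! f p' # drop (Suc (f p')) w"
        using \<open>f p' < N\<close> w(1) by (simp add: Cons_nth_drop_Suc)
      then show ?thesis
        using y segment_eq[OF f(1) p', of w] by (cases "f (p' @ [x]) - f p'") simp_all
    qed
    ultimately have "f p = f p'" using nth_eq_iff_index_eq[of w "f p" "f p'"] w \<open>f p' < N\<close> by simp
    then show False using f(2) by simp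
  qed
  then show ?thesis using f(1) by blast
qed

end

section \<open>Words of a term\<close>

text \<open>The value on \<open>[]\<close> is a default: the signature has no constant for the empty
  word.\<close>

fun word_trm :: "nat list \<Rightarrow> trm" where
  "word_trm [] = Var 0"
| "word_trm [x] = Var x"
| "word_trm (x # y # u) = Times (Var x) (word_trm (y # u))"

text \<open>The monomials left after distributing all products over sums.\<close>

fun words :: "trm \<Rightarrow> nat list set" where
  "words (Var x) = {[x]}"
| "words (Plus s t) = words s \<union> words t"
| "words (Times s t) = {u @ v | u v. u \<in> words s \<and> v \<in> words t}"

fun vars :: "trm \<Rightarrow> nat set" where
  "vars (Var x) = {x}"
| "vars (Plus s t) = vars s \<union> vars t"
| "vars (Times s t) = vars s \<union> vars t"

lemma word_trm_Cons: "u \<noteq> [] \<Longrightarrow> word_trm (x # u) = Times (Var x) (word_trm u)"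
  by (cases u) auto

lemma words_word_trm: "u \<noteq> [] \<Longrightarrow> words (word_trm u) = {u}"
  by (induction u rule: word_trm.induct) auto

lemma words_nonempty: "words t \<noteq> {}"
  by (induction t) auto

lemma Nil_notin_words: "[] \<notin> words t"
  by (induction t) auto

lemma finite_vars: "finite (vars t)"
  by (induction t) auto

lemma subst_subst: "subst \<sigma> (subst \<tau> t) = subst (\<lambda>x. subst \<sigma> (\<tau> x)) t"
  by (induction t) auto

lemma subst_id: "(\<And>x. x \<in> vars t \<Longrightarrow> \<sigma> x = Var x) \<Longrightarrow> subst \<sigma> t = t"
  by (induction t) auto

lemma subst_word_trm:
  "u \<noteq> [] \<Longrightarrow> subst (\<lambda>x. Var (f x)) (word_trm u) = word_trm (map f u)"
  by (induction u rule: word_trm.induct) auto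

lemma derivable_subst: "derivable E s t \<Longrightarrow> derivable E (subst \<sigma> s) (subst \<sigma> t)"
  by (induction rule: derivable.induct)
    (auto simp: subst_subst intro: derivable.intros)

section \<open>The identities\<close>

text \<open>The square of a variable plays the role of the missing constant \<open>0\<close>.\<close>

abbreviation zero_trm :: trm where
  "zero_trm \<equiv> Times (Var 0) (Var 0)"

definition semiring_axioms :: "identity set" where
  "semiring_axioms =
    {(Plus (Plus (Var 0) (Var 1)) (Var 2), Plus (Var 0) (Plus (Var 1) (Var 2))),
     (Plus (Var 0) (Var 1), Plus (Var 1) (Var 0)),
     (Plus (Var 0) (Var 0), Var 0),
     (Times (Times (Var 0) (Var 1)) (Var 2), Times (Var 0) (Times (Var 1) (Var 2))),
     (Times (Var 0) (Plus (Var 1) (Var 2)), Plus (Times (Var 0) (Var 1)) (Times (Var 0) (Var 2))),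
     (Times (Plus (Var 0) (Var 1)) (Var 2), Plus (Times (Var 0) (Var 2)) (Times (Var 1) (Var 2)))}"

text \<open>In each of the listed words and sums of two words, the variable \<open>1\<close> would have to occupy two
  different segments of a linear word.\<close>

definition zero_axioms :: "identity set" where
  "zero_axioms =
    {(Plus zero_trm (Var 1), zero_trm),
     (Times zero_trm (Var 1), zero_trm),
     (Times (Var 1) zero_trm, zero_trm)} \<union>
    (\<lambda>t. (t, zero_trm)) `
     {word_trm [1, 1],
      word_trm [1, 2, 1],
      Plus (word_trm [1]) (word_trm [1, 2]),
      Plus (word_trm [1]) (word_trm [2, 1]),
      Plus (word_trm [1]) (word_trm [2, 1, 3]),
      Plus (word_trm [1, 2]) (word_trm [3, 1]),
      Plus (word_trm [1, 2]) (word_trm [3, 1, 4]),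
      Plus (word_trm [2, 1]) (word_trm [3, 1, 4])}"

text \<open>These yield \<open>splice\<close> and \<open>rectangle\<close> for nonempty contexts. A
  variable cannot stand for the empty word; empty contexts are settled by the zero
  identities.\<close>

definition exchange_axioms :: "identity set" where
  "exchange_axioms =
    (\<lambda>(s, u). (Plus s (word_trm u), s)) `
     {(Plus (word_trm [1, 0, 2]) (word_trm [3, 0, 4]), [1, 0, 4]),
      (Plus (word_trm [0, 2]) (Plus (word_trm [0, 3]) (word_trm [1, 2])), [1, 3])}"

definition base_axioms :: "identity set" where
  "base_axioms = semiring_axioms \<union> zero_axioms \<union> exchange_axioms"

definition long_axiom :: "nat \<Rightarrow> identity" where
  "long_axiom m = (word_trm [0..<Suc m], zero_trm)"

text \<open>If values have length at most \<open>m\<close>, then \<open>m\<close> variables with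
  nonzero product take single letters. Two such words with the same value agree position by position
  and may be crossed after position \<open>i\<close>.\<close>

definition cross_axiom :: "nat \<Rightarrow> nat \<Rightarrow> identity" where
  "cross_axiom m i =
    (let s = Plus (word_trm [0..<m]) (word_trm [m..<m + m])
     in (Plus s (word_trm ([0..<i] @ [m + i..<m + m])), s))"

locale word_theory =
  fixes E :: "identity set"
  assumes base: "base_axioms \<subseteq> E"
begin

section \<open>Equational calculus and the order given by addition\<close>

abbreviation eqv (infix "\<approx>" 50) where
  "s \<approx> t \<equiv> derivable E s t"

text \<open>\<open>Plus\<close> is the join of this preorder and, by \<open>zero_plus\<close>,
  \<open>zero_trm\<close> is a greatest element.\<close>

abbreviation below (infix "\<sqsubseteq>" 50) where
  "s \<sqsubseteq> t \<equiv> Plus t s \<approx> t"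

lemmas eqv_trans [trans] = derivable.trans
lemmas eqv_sym = derivable.sym
lemmas plus_cong = derivable.plus
lemmas times_cong = derivable.times

text \<open>Substitutions are entered as lists, variable \<open>i\<close> receiving entry
  \<open>i\<close>. For the zero identities entry 0 is \<open>Var 0\<close>, which leaves
  \<open>zero_trm\<close> on the right unchanged.\<close>

lemma axI:
  "(s, t) \<in> base_axioms \<Longrightarrow> subst ((!) xs) s = s' \<Longrightarrow> subst ((!) xs) t = t' \<Longrightarrow> s' \<approx> t'"
  using base by (auto intro: derivable.ax)

lemma plus_assoc: "Plus (Plus a b) c \<approx> Plus a (Plus b c)"
  by (rule axI[of "Plus (Plus (Var 0) (Var 1)) (Var 2)"
        "Plus (Var 0) (Plus (Var 1) (Var 2))" "[a, b, c]"])
    (simp_all add: base_axioms_def semiring_axioms_def)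

lemma plus_comm: "Plus a b \<approx> Plus b a"
  by (rule axI[of "Plus (Var 0) (Var 1)"
        "Plus (Var 1) (Var 0)" "[a, b]"])
    (simp_all add: base_axioms_def semiring_axioms_def)

lemma plus_idem: "Plus a a \<approx> a"
  by (rule axI[of "Plus (Var 0) (Var 0)"
        "Var 0" "[a]"])
    (simp_all add: base_axioms_def semiring_axioms_def)

lemma times_assoc: "Times (Times a b) c \<approx> Times a (Times b c)"
  by (rule axI[of "Times (Times (Var 0) (Var 1)) (Var 2)"
        "Times (Var 0) (Times (Var 1) (Var 2))" "[a, b, c]"])
    (simp_all add: base_axioms_def semiring_axioms_def)

lemma distrib_left: "Times a (Plus b c) \<approx> Plus (Times a b) (Times a c)"
  by (rule axI[of "Times (Var 0) (Plus (Var 1) (Var 2))"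
        "Plus (Times (Var 0) (Var 1)) (Times (Var 0) (Var 2))" "[a, b, c]"])
    (simp_all add: base_axioms_def semiring_axioms_def)

lemma distrib_right: "Times (Plus a b) c \<approx> Plus (Times a c) (Times b c)"
  by (rule axI[of "Times (Plus (Var 0) (Var 1)) (Var 2)"
        "Plus (Times (Var 0) (Var 2)) (Times (Var 1) (Var 2))" "[a, b, c]"])
    (simp_all add: base_axioms_def semiring_axioms_def)

lemma eqv_below: "a \<approx> b \<Longrightarrow> a \<sqsubseteq> b"
  by (rule eqv_trans[OF plus_cong[OF derivable.refl] plus_idem])

lemma below_refl: "a \<sqsubseteq> a"
  by (rule plus_idem)

lemma below_trans:
  assumes "a \<sqsubseteq> b" "b \<sqsubseteq> c"
  shows "a \<sqsubseteq> c"
proof -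
  have "Plus c a \<approx> Plus (Plus c b) a"
    by (rule plus_cong[OF eqv_sym[OF assms(2)] derivable.refl])
  also have "\<dots> \<approx> Plus c (Plus b a)" by (rule plus_assoc)
  also have "\<dots> \<approx> Plus c b" by (rule plus_cong[OF derivable.refl assms(1)])
  also have "\<dots> \<approx> c" by (rule assms(2))
  finally show ?thesis .
qed

lemma plus_below:
  assumes "a \<sqsubseteq> c" "b \<sqsubseteq> c"
  shows "Plus a b \<sqsubseteq> c"
proof -
  have "Plus c (Plus a b) \<approx> Plus (Plus c a) b" by (rule eqv_sym[OF plus_assoc])
  also have "\<dots> \<approx> Plus c b" by (rule plus_cong[OF assms(1) derivable.refl])
  also have "\<dots> \<approx> c" by (rule assms(2))
  finally show ?thesis .
qed

lemma below_plus2: "b \<sqsubseteq> Plus a b"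
  by (rule eqv_trans[OF plus_assoc plus_cong[OF derivable.refl plus_idem]])

lemma below_plus1: "a \<sqsubseteq> Plus a b"
  using below_trans[OF below_plus2 eqv_below[OF plus_comm]] .

lemma below_antisym: "a \<sqsubseteq> b \<Longrightarrow> b \<sqsubseteq> a \<Longrightarrow> a \<approx> b"
  by (rule eqv_trans[OF eqv_trans[OF eqv_sym plus_comm]])

lemma times_mono:
  assumes "a \<sqsubseteq> b" "c \<sqsubseteq> d"
  shows "Times a c \<sqsubseteq> Times b d"
proof -
  have "Plus (Times b d) (Times b c) \<approx> Times b (Plus d c)"
    by (rule eqv_sym[OF distrib_left])
  also have "\<dots> \<approx> Times b d" by (rule times_cong[OF derivable.refl assms(2)])
  finally have *: "Times b c \<sqsubseteq> Times b d" .
  have "Plus (Times b c) (Times a c) \<approx> Times (Plus b a) c"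
    by (rule eqv_sym[OF distrib_right])
  also have "\<dots> \<approx> Times b c" by (rule times_cong[OF assms(1) derivable.refl])
  finally show ?thesis using * by (rule below_trans)
qed

lemma word_trm_append:
  "u \<noteq> [] \<Longrightarrow> v \<noteq> [] \<Longrightarrow> word_trm (u @ v) \<approx> Times (word_trm u) (word_trm v)"
proof (induction u rule: word_trm.induct)
  case (3 x y u)
  have "word_trm ((x # y # u) @ v) \<approx> Times (Var x) (Times (word_trm (y # u)) (word_trm v))"
    using 3 by (auto intro: derivable.intros)
  also have "\<dots> \<approx> Times (word_trm (x # y # u)) (word_trm v)"
    using eqv_sym[OF times_assoc] by simp
  finally show ?case .
qed (auto simp: word_trm_Cons intro: derivable.intros)

lemma word_trm_append3:
  assumes "u \<noteq> []" "v \<noteq> []" "z \<noteq> []"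
  shows "word_trm (u @ v @ z) \<approx> Times (word_trm u) (Times (word_trm v) (word_trm z))"
  using eqv_trans[OF word_trm_append[of u "v @ z"]
      times_cong[OF derivable.refl word_trm_append[of v z]]] assms
  by simp

text \<open>Together with \<open>below_of_words\<close> this makes a term the join of its
  words.\<close>

lemma word_below: "u \<in> words t \<Longrightarrow> word_trm u \<sqsubseteq> t"
proof (induction t arbitrary: u)
  case (Var x)
  then show ?case by (simp add: below_refl)
next
  case (Plus t1 t2)
  then show ?case by (auto intro: below_trans[OF _ below_plus1] below_trans[OF _ below_plus2])
next
  case (Times t1 t2)
  then obtain a b where "u = a @ b" "a \<in> words t1" "b \<in> words t2" by auto
  moreover from this have "a \<noteq> []" "b \<noteq> []" using Nil_notin_words by metis+
  ultimately show ?case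
    using below_trans[OF eqv_below[OF word_trm_append] times_mono[OF Times.IH]] by simp
qed

text \<open>The context \<open>f\<close> lets the induction pass through products: the first factor
  is expanded with the second held fixed, then the second next to a word of the first.\<close>

lemma below_of_words_context:
  assumes "\<And>x y. f (Plus x y) \<sqsubseteq> Plus (f x) (f y)"
    and "\<And>x y. x \<sqsubseteq> y \<Longrightarrow> f x \<sqsubseteq> f y"
    and "\<And>u. u \<in> words t \<Longrightarrow> f (word_trm u) \<sqsubseteq> s"
  shows "f t \<sqsubseteq> s"
  using assms
proof (induction t arbitrary: f)
  case (Var x)
  then show ?case using Var.prems(3)[of "[x]"] by simp
next
  case (Plus t1 t2)
  have "f t1 \<sqsubseteq> s" "f t2 \<sqsubseteq> s" using Plus.IH[of f] Plus.prems by auto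
  then show ?case using Plus.prems(1) plus_below below_trans by blast
next
  case (Times t1 t2)
  show ?case
  proof (rule Times.IH(1)[where f = "\<lambda>x. f (Times x t2)"])
    fix x y
    show "f (Times (Plus x y) t2) \<sqsubseteq> Plus (f (Times x t2)) (f (Times y t2))"
      using below_trans[OF Times.prems(2)[OF eqv_below[OF distrib_right]] Times.prems(1)] .
    show "f (Times x t2) \<sqsubseteq> f (Times y t2)" if "x \<sqsubseteq> y"
      using that by (intro Times.prems(2) times_mono below_refl)
  next
    fix u assume u: "u \<in> words t1"
    show "f (Times (word_trm u) t2) \<sqsubseteq> s"
    proof (rule Times.IH(2)[where f = "\<lambda>y. f (Times (word_trm u) y)"])
      fix x y
      show "f (Times (word_trm u) (Plus x y))
          \<sqsubseteq> Plus (f (Times (word_trm u) x)) (f (Times (word_trm u) y))"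
        using below_trans[OF Times.prems(2)[OF eqv_below[OF distrib_left]] Times.prems(1)] .
      show "f (Times (word_trm u) x) \<sqsubseteq> f (Times (word_trm u) y)" if "x \<sqsubseteq> y"
        using that by (intro Times.prems(2) times_mono below_refl)
    next
      fix v assume v: "v \<in> words t2"
      have "u \<noteq> []" "v \<noteq> []" using u v Nil_notin_words by metis+
      then have "f (Times (word_trm u) (word_trm v)) \<sqsubseteq> f (word_trm (u @ v))"
        by (intro Times.prems(2) eqv_below eqv_sym[OF word_trm_append])
      moreover have "f (word_trm (u @ v)) \<sqsubseteq> s" using u v by (intro Times.prems(3)) auto
      ultimately show "f (Times (word_trm u) (word_trm v)) \<sqsubseteq> s" by (rule below_trans)
    qed
  qed
qed

lemma below_of_words: "(\<And>u. u \<in> words t \<Longrightarrow> word_trm u \<sqsubseteq> s) \<Longrightarrow> t \<sqsubseteq> s"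
  by (rule below_of_words_context[where f = "\<lambda>x. x"]) (auto intro: below_refl)

section \<open>Consequences of the zero and exchange identities\<close>

lemma zero_square: "Times a a \<approx> zero_trm"
  by (rule axI[of "word_trm [1, 1]"
        "zero_trm" "[Var 0, a]"])
    (simp_all add: base_axioms_def zero_axioms_def)

lemma zero_plus: "Plus zero_trm t \<approx> zero_trm"
  by (rule axI[of "Plus zero_trm (Var 1)"
        "zero_trm" "[Var 0, t]"])
    (simp_all add: base_axioms_def zero_axioms_def)

lemma zero_times: "Times zero_trm t \<approx> zero_trm"
  by (rule axI[of "Times zero_trm (Var 1)"
        "zero_trm" "[Var 0, t]"])
    (simp_all add: base_axioms_def zero_axioms_def)

lemma times_zero: "Times t zero_trm \<approx> zero_trm"
  by (rule axI[of "Times (Var 1) zero_trm"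
        "zero_trm" "[Var 0, t]"])
    (simp_all add: base_axioms_def zero_axioms_def)

lemma zero_sandwich: "Times a (Times b a) \<approx> zero_trm"
  by (rule axI[of "word_trm [1, 2, 1]"
        "zero_trm" "[Var 0, a, b]"])
    (simp_all add: base_axioms_def zero_axioms_def)

lemma zero_absorbs: "zero_trm \<sqsubseteq> t \<Longrightarrow> t \<approx> zero_trm"
  by (rule below_antisym[OF zero_plus])

lemma zero_factor:
  assumes "word_trm v \<approx> zero_trm" "v \<noteq> []"
  shows "word_trm (u @ v @ z) \<approx> zero_trm"
proof -
  have *: "word_trm (v @ z) \<approx> zero_trm"
  proof (cases "z = []")
    case False
    show ?thesis
      using eqv_trans[OF word_trm_append[OF assms(2) False]
          eqv_trans[OF times_cong[OF assms(1) derivable.refl] zero_times]] .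
  qed (use assms in simp)
  show ?thesis
  proof (cases "u = []")
    case False
    have "v @ z \<noteq> []" using assms(2) by simp
    show ?thesis
      using eqv_trans[OF word_trm_append[OF False \<open>v @ z \<noteq> []\<close>]
          eqv_trans[OF times_cong[OF derivable.refl *] times_zero]] .
  qed (use * in simp)
qed

lemma zero_nondistinct:
  assumes "\<not> distinct u"
  shows "word_trm u \<approx> zero_trm"
proof -
  obtain a b c x where u: "u = a @ ([x] @ b @ [x]) @ c"
    using not_distinct_decomp[OF assms] by auto
  have "word_trm ([x] @ b @ [x]) \<approx> zero_trm"
  proof (cases "b = []")
    case True
    then show ?thesis using zero_square by simp
  next
    case False
    show ?thesis
      using eqv_trans[OF word_trm_append3[of "[x]" b "[x]"] zero_sandwich] False by simp
  qed
  then show ?thesis unfolding u by (rule zero_factor) simp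
qed

lemma zero_loop_right: "Plus a (Times a q) \<approx> zero_trm"
  by (rule axI[of "Plus (word_trm [1]) (word_trm [1, 2])"
        "zero_trm" "[Var 0, a, q]"])
    (simp_all add: base_axioms_def zero_axioms_def)

lemma zero_loop_left: "Plus a (Times p a) \<approx> zero_trm"
  by (rule axI[of "Plus (word_trm [1]) (word_trm [2, 1])"
        "zero_trm" "[Var 0, a, p]"])
    (simp_all add: base_axioms_def zero_axioms_def)

lemma zero_loop_both: "Plus a (Times p (Times a q)) \<approx> zero_trm"
  by (rule axI[of "Plus (word_trm [1]) (word_trm [2, 1, 3])"
        "zero_trm" "[Var 0, a, p, q]"])
    (simp_all add: base_axioms_def zero_axioms_def)

lemma zero_shift: "Plus (Times a q) (Times p a) \<approx> zero_trm"
  by (rule axI[of "Plus (word_trm [1, 2]) (word_trm [3, 1])"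
        "zero_trm" "[Var 0, a, q, p]"])
    (simp_all add: base_axioms_def zero_axioms_def)

lemma zero_first: "Plus (Times a q) (Times p (Times a r)) \<approx> zero_trm"
  by (rule axI[of "Plus (word_trm [1, 2]) (word_trm [3, 1, 4])"
        "zero_trm" "[Var 0, a, q, p, r]"])
    (simp_all add: base_axioms_def zero_axioms_def)

lemma zero_last: "Plus (Times p a) (Times r (Times a q)) \<approx> zero_trm"
  by (rule axI[of "Plus (word_trm [2, 1]) (word_trm [3, 1, 4])"
        "zero_trm" "[Var 0, a, p, r, q]"])
    (simp_all add: base_axioms_def zero_axioms_def)

lemma exchange_splice: "Times p (Times a s) \<sqsubseteq> Plus (Times p (Times a q)) (Times r (Times a s))"
  by (rule axI[of "Plus (Plus (word_trm [1, 0, 2]) (word_trm [3, 0, 4])) (word_trm [1, 0, 4])"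
        "Plus (word_trm [1, 0, 2]) (word_trm [3, 0, 4])" "[a, p, q, r, s]"])
    (simp_all add: base_axioms_def exchange_axioms_def)

lemma exchange_rectangle: "Times p' q' \<sqsubseteq> Plus (Times p q) (Plus (Times p q') (Times p' q))"
  by (rule axI[of "Plus (Plus (word_trm [0, 2]) (Plus (word_trm [0, 3]) (word_trm [1, 2]))) (word_trm [1, 3])"
        "Plus (word_trm [0, 2]) (Plus (word_trm [0, 3]) (word_trm [1, 2]))" "[p, p', q, q']"])
    (simp_all add: base_axioms_def exchange_axioms_def)

text \<open>The join of \<open>a\<close> and \<open>b\<close> is still below \<open>t\<close>, and
  \<open>zero_trm\<close> is greatest.\<close>

lemma zero_of_clash:
  assumes "Plus a b \<approx> zero_trm" "a \<sqsubseteq> t" "b \<sqsubseteq> t"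
  shows "t \<approx> zero_trm"
  using below_trans[OF eqv_below[OF eqv_sym[OF assms(1)]] plus_below[OF assms(2,3)]]
  by (rule zero_absorbs)

end

section \<open>The language absorbed by a term\<close>

text \<open>For a finite initial segment of the positive integers the premises on \<open>m\<close>
  single out the largest length; if all positive lengths occur, they are never met.\<close>

locale bounded_word_theory = word_theory +
  fixes lens :: "nat set"
  assumes one_lens: "1 \<in> lens"
    and long: "m \<in> lens \<Longrightarrow> Suc m \<notin> lens \<Longrightarrow> long_axiom m \<in> E"
    and crossing: "m \<in> lens \<Longrightarrow> Suc m \<notin> lens \<Longrightarrow> i \<le> m \<Longrightarrow> cross_axiom m i \<in> E"
begin

definition absorbed :: "trm \<Rightarrow> nat list set" where
  "absorbed t = {u. u \<noteq> [] \<and> word_trm u \<sqsubseteq> t}"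

lemma words_absorbed: "words t \<subseteq> absorbed t"
  using word_below Nil_notin_words by (fastforce simp: absorbed_def)

lemma zero_long:
  assumes "u \<noteq> []" "length u \<notin> lens"
  shows "word_trm u \<approx> zero_trm"
proof -
  \<comment> \<open>The least missing length has its predecessor in \<open>lens\<close>, so the long
    identity applies to the prefix of length \<open>n\<close>.\<close>
  define n where "n = (LEAST n. 0 < n \<and> n \<notin> lens)"
  have n: "0 < n" "n \<notin> lens"
    using LeastI[of "\<lambda>n. 0 < n \<and> n \<notin> lens" "length u"] assms by (auto simp: n_def)
  have "n \<le> length u"
    using Least_le[of "\<lambda>n. 0 < n \<and> n \<notin> lens" "length u"] assms by (auto simp: n_def)
  obtain m where m: "n = Suc m" using n(1) gr0_implies_Suc by blast
  have "m \<noteq> 0" using n(2) one_lens unfolding m by (cases m) simp_all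
  then have "m \<in> lens"
    using not_less_Least[of m "\<lambda>n. 0 < n \<and> n \<notin> lens"] m by (auto simp: n_def)
  then have ax: "(word_trm [0..<n], zero_trm) \<in> E"
    using long n(2) by (auto simp: m long_axiom_def)
  have "map ((!) u) [0..<n] = take n u"
    using \<open>n \<le> length u\<close> by (intro nth_equalityI) auto
  \<comment> \<open>Variable 0 also occurs in the long word, so the substitution turns
    \<open>zero_trm\<close> into another square.\<close>
  then have "word_trm (take n u) \<approx> Times (Var (u ! 0)) (Var (u ! 0))"
    using derivable.ax[OF ax, of "\<lambda>k. Var (u ! k)"] n(1) subst_word_trm[of "[0..<n]" "(!) u"]
    by simp
  then have "word_trm ([] @ take n u @ drop n u) \<approx> zero_trm"
    using n(1) assms(1) by (intro zero_factor[OF eqv_trans[OF _ zero_square]]) auto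
  then show ?thesis by simp
qed

lemma cross_below:
  assumes "length u = m" "length v = m" "m \<in> lens" "Suc m \<notin> lens" "i \<le> m" "0 < m"
  shows "word_trm (take i u @ drop i v) \<sqsubseteq> Plus (word_trm u) (word_trm v)"
proof -
  \<comment> \<open>The first \<open>m\<close> variables spell \<open>u\<close>, the next
    \<open>m\<close> spell \<open>v\<close>.\<close>
  let ?f = "(!) (u @ v)"
  have 1: "map ?f [0..<m] = u" "map ?f [m..<m + m] = v"
    using assms by (auto intro!: nth_equalityI simp: nth_append)
  have 2: "map ?f ([0..<i] @ [m + i..<m + m]) = take i u @ drop i v"
    using assms by (auto intro!: nth_equalityI simp: nth_append)
  have ne: "[0..<m] \<noteq> []" "[m..<m + m] \<noteq> []" "[0..<i] @ [m + i..<m + m] \<noteq> []"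
    using assms by auto
  show ?thesis
    using derivable.ax[OF crossing[OF assms(3-5), unfolded cross_axiom_def Let_def],
        of "\<lambda>k. Var (?f k)"]
    unfolding subst.simps ne[THEN subst_word_trm] 1 2 .
qed

section \<open>The absorbed language of a nonzero term is closed\<close>

context
  fixes t :: trm
  assumes nonzero: "\<not> t \<approx> zero_trm"
begin

lemma absorbed_nonzero: "u \<in> absorbed t \<Longrightarrow> \<not> word_trm u \<approx> zero_trm"
proof
  assume "u \<in> absorbed t" "word_trm u \<approx> zero_trm"
  then have "zero_trm \<sqsubseteq> t"
    using below_trans[OF eqv_below[OF eqv_sym]] by (simp add: absorbed_def)
  then show False using zero_absorbs nonzero by blast
qed

lemma absorbed_distinct: "u \<in> absorbed t \<Longrightarrow> distinct u"
  using absorbed_nonzero zero_nondistinct by blast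

text \<open>A letter of \<open>u\<close> that does not occur in \<open>t\<close> may be replaced by its square,
  which turns \<open>u\<close> into zero.\<close>

lemma absorbed_vars:
  assumes "u \<in> absorbed t"
  shows "set u \<subseteq> vars t"
proof
  fix x assume x: "x \<in> set u"
  show "x \<in> vars t"
  proof (rule ccontr)
    assume "x \<notin> vars t"
    define \<sigma> where "\<sigma> = Var(x := Times (Var x) (Var x))"
    have "subst \<sigma> (word_trm u) \<approx> zero_trm"
      using x
    proof (induction u rule: word_trm.induct)
      case (3 y z v)
      show ?case
      proof (cases "x = y")
        case True
        have "\<sigma> y \<approx> zero_trm" using True by (simp add: \<sigma>_def zero_square)
        then show ?thesis
          using eqv_trans[OF times_cong[OF _ derivable.refl] zero_times] by simp
      next
        case False
        then have "subst \<sigma> (word_trm (z # v)) \<approx> zero_trm" using 3 by simp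
        then show ?thesis
          using eqv_trans[OF times_cong[OF derivable.refl] times_zero] by simp
      qed
    qed (auto simp: \<sigma>_def zero_square)
    moreover have "subst \<sigma> t = t"
      using \<open>x \<notin> vars t\<close> by (intro subst_id) (auto simp: \<sigma>_def)
    then have "subst \<sigma> (word_trm u) \<sqsubseteq> t"
      using assms derivable_subst[of E "Plus t (word_trm u)" t \<sigma>] by (simp add: absorbed_def)
    ultimately have "zero_trm \<sqsubseteq> t"
      using below_trans[OF eqv_below[OF eqv_sym]] by blast
    then show False using zero_absorbs nonzero by blast
  qed
qed

lemma finite_absorbed: "finite (absorbed t)"
proof (rule finite_subset)
  show "absorbed t \<subseteq> {u. set u \<subseteq> vars t \<and> length u \<le> card (vars t)}"
    using absorbed_vars absorbed_distinct finite_vars card_mono distinct_card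
    by (metis (mono_tags, lifting) mem_Collect_eq subsetI)
qed (rule finite_lists_length_le[OF finite_vars])

lemma absorbed_clash:
  assumes "u \<in> absorbed t" "v \<in> absorbed t"
    and "word_trm u \<approx> a" "word_trm v \<approx> b" "Plus a b \<approx> zero_trm"
  shows False
  using zero_of_clash[OF assms(5), of t] assms nonzero
    below_trans[OF eqv_below[OF eqv_sym[OF assms(3)]], of t]
    below_trans[OF eqv_below[OF eqv_sym[OF assms(4)]], of t]
  by (simp add: absorbed_def)

text \<open>Otherwise \<open>x\<close> would both begin the common value and occur later in it. Each
  combination of empty and nonempty remainders calls for its own zero identity.\<close>

lemma first_clash:
  assumes "x # q \<in> absorbed t" "p @ x # q' \<in> absorbed t"
  shows "p = []"
proof (rule ccontr)
  assume p: "p \<noteq> []"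
  have q: "word_trm (x # q) \<approx> Times (Var x) (word_trm q)" if "q \<noteq> []" for q
    using that by (simp add: word_trm_Cons derivable.refl)
  have pq: "word_trm (p @ x # q) \<approx> Times (word_trm p) (Times (Var x) (word_trm q))"
    if "q \<noteq> []" for q
    using word_trm_append[of p "x # q"] p that by (simp add: word_trm_Cons)
  have p1: "word_trm (p @ [x]) \<approx> Times (word_trm p) (Var x)"
    using word_trm_append[of p "[x]"] p by simp
  have x1: "word_trm [x] \<approx> Var x" by (simp add: derivable.refl)
  show False
  proof (cases "q = []"; cases "q' = []")
    assume "q = []" "q' = []"
    then show False using absorbed_clash[OF assms _ _ zero_loop_left] x1 p1 by simp
  next
    assume "q = []" "q' \<noteq> []"
    then show False using absorbed_clash[OF assms _ pq zero_loop_both] x1 by simp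
  next
    assume "q \<noteq> []" "q' = []"
    then show False using absorbed_clash[OF assms q _ zero_shift] p1 by simp
  next
    assume "q \<noteq> []" "q' \<noteq> []"
    then show False using absorbed_clash[OF assms q pq zero_first] by simp
  qed
qed

text \<open>Mirror image of \<open>first_clash\<close>, which shows that \<open>p\<close> and
  \<open>p'\<close> are both empty if one of them is.\<close>

lemma last_clash:
  assumes "p @ [x] \<in> absorbed t" "p' @ x # q \<in> absorbed t"
  shows "q = []"
proof (rule ccontr)
  assume q: "q \<noteq> []"
  have x: "word_trm (x # q) \<approx> Times (Var x) (word_trm q)"
    using q by (simp add: word_trm_Cons derivable.refl)
  show False
  proof (cases "p = [] \<or> p' = []")
    case True
    then have "p = []" "p' = []"
      using first_clash[of x "[]" p' q] first_clash[of x q p "[]"] assms by auto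
    then show False
      using absorbed_clash[OF assms _ _ zero_loop_right, of "Var x" "word_trm q"] x
      by (simp add: derivable.refl)
  next
    case False
    have "word_trm (p @ [x]) \<approx> Times (word_trm p) (Var x)"
      using word_trm_append[of p "[x]"] False by simp
    moreover have "word_trm (p' @ x # q) \<approx> Times (word_trm p') (Times (Var x) (word_trm q))"
      using word_trm_append[of p' "x # q"] False q by (simp add: word_trm_Cons)
    ultimately show False by (rule absorbed_clash[OF assms _ _ zero_last])
  qed
qed

lemma absorbed_suffix_free: "u \<in> absorbed t \<Longrightarrow> p @ u \<in> absorbed t \<Longrightarrow> p = []"
  using first_clash[of "hd u" "tl u" p "tl u"] by (cases u) (auto simp: absorbed_def)

lemma absorbed_prefix_free: "u \<in> absorbed t \<Longrightarrow> u @ q \<in> absorbed t \<Longrightarrow> q = []"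
  using last_clash[of "butlast u" "last u" "butlast u" q]
  by (cases u rule: rev_cases) (auto simp: absorbed_def)

lemma absorbed_rectangle:
  assumes "p @ q \<in> absorbed t" "p @ q' \<in> absorbed t" "p' @ q \<in> absorbed t"
  shows "p' @ q' \<in> absorbed t"
proof (cases "p = [] \<or> q = [] \<or> p' = [] \<or> q' = []")
  case True
  \<comment> \<open>An empty context forces its counterpart to be empty, and the conclusion becomes
    one of the assumptions.\<close>
  have "p' = []" if "p = []" using that assms absorbed_suffix_free[of q p'] by simp
  moreover have "q' = []" if "q = []" using that assms absorbed_prefix_free[of p q'] by simp
  moreover have "p = []" if "p' = []" using that assms absorbed_suffix_free[of q p] by simp
  moreover have "q = []" if "q' = []" using that assms absorbed_prefix_free[of p q] by simp
  ultimately have "p = [] \<and> p' = [] \<or> q = [] \<and> q' = []" using True by blast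
  then show ?thesis using assms by (elim disjE conjE) simp_all
next
  case False
  have eq: "Times (word_trm a) (word_trm b) \<sqsubseteq> t" if "a @ b \<in> absorbed t" "a \<noteq> []" "b \<noteq> []" for a b
    using below_trans[OF eqv_below[OF eqv_sym[OF word_trm_append[OF that(2,3)]]]] that
    by (simp add: absorbed_def)
  have "Times (word_trm p') (word_trm q') \<sqsubseteq> t"
    by (rule below_trans[OF exchange_rectangle[where p = "word_trm p" and q = "word_trm q"]],
        intro plus_below eq) (use assms False in auto)
  then show ?thesis
    using below_trans[OF eqv_below[OF word_trm_append[of p' q']]] False
    by (simp add: absorbed_def)
qed

lemma absorbed_splice:
  assumes "p @ x # q \<in> absorbed t" "p' @ x # q' \<in> absorbed t"
  shows "p @ x # q' \<in> absorbed t"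
proof (cases "p = [] \<or> q = [] \<or> p' = [] \<or> q' = []")
  case True
  have "p' = []" if "p = []" using that assms first_clash[of x q p' q'] by simp
  moreover have "p = []" if "p' = []" using that assms first_clash[of x q' p q] by simp
  moreover have "q' = []" if "q = []" using that assms last_clash[of p x p' q'] by simp
  moreover have "q = []" if "q' = []" using that assms last_clash[of p' x p q] by simp
  ultimately have "p = [] \<and> p' = [] \<or> q = [] \<and> q' = []" using True by blast
  then show ?thesis using assms by (elim disjE conjE) simp_all
next
  case False
  have *: "word_trm (a @ x # b) \<approx> Times (word_trm a) (Times (Var x) (word_trm b))"
    if "a \<noteq> []" "b \<noteq> []" for a b
    using word_trm_append[of a "x # b"] that by (simp add: word_trm_Cons)
  have eq: "Times (word_trm a) (Times (Var x) (word_trm b)) \<sqsubseteq> t"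
    if "a @ x # b \<in> absorbed t" "a \<noteq> []" "b \<noteq> []" for a b
    using below_trans[OF eqv_below[OF eqv_sym[OF *[OF that(2,3)]]]] that
    by (simp add: absorbed_def)
  have "Times (word_trm p) (Times (Var x) (word_trm q')) \<sqsubseteq> t"
    by (rule below_trans[OF exchange_splice[where q = "word_trm q" and r = "word_trm p'"]],
        intro plus_below eq) (use assms False in auto)
  then show ?thesis
    using below_trans[OF eqv_below[OF *[of p q']]] False by (simp add: absorbed_def)
qed

lemma absorbed_cross:
  assumes "u \<in> absorbed t" "v \<in> absorbed t" "length u = length v" "length u \<in> lens"
    "Suc (length u) \<notin> lens"
  shows "take i u @ drop i v \<in> absorbed t"
proof (cases "i \<le> length u")
  case True
  have "word_trm (take i u @ drop i v) \<sqsubseteq> Plus (word_trm u) (word_trm v)"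
    using assms True by (intro cross_below) (auto simp: absorbed_def)
  moreover have "Plus (word_trm u) (word_trm v) \<sqsubseteq> t"
    using assms by (intro plus_below) (auto simp: absorbed_def)
  ultimately have "word_trm (take i u @ drop i v) \<sqsubseteq> t" by (rule below_trans)
  then show ?thesis using assms True by (auto simp: absorbed_def)
next
  case False
  then show ?thesis using assms by simp
qed

lemma closed_absorbed: "closed_language (absorbed t) lens"
proof
  show "absorbed t \<noteq> {}" using words_absorbed words_nonempty by blast
  show lens: "length u \<in> lens" if "u \<in> absorbed t" for u
    using that zero_long absorbed_nonzero by (auto simp: absorbed_def)
  show "take i u @ drop i v \<in> absorbed t"
    if "u \<in> absorbed t" "v \<in> absorbed t" "length u = length v" "Suc (length u) \<notin> lens" for u v i
    using absorbed_cross that lens by blast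
  show "finite (absorbed t)" by (rule finite_absorbed)
  show "[] \<notin> absorbed t" by (simp add: absorbed_def)
  show "p @ x # q' \<in> absorbed t" if "p @ x # q \<in> absorbed t" "p' @ x # q' \<in> absorbed t"
    for p x q p' q' using that by (rule absorbed_splice)
  show "p = []" if "u \<in> absorbed t" "p @ u \<in> absorbed t" for u p
    using that by (rule absorbed_suffix_free)
  show "q = []" if "u \<in> absorbed t" "u @ q \<in> absorbed t" for u q
    using that by (rule absorbed_prefix_free)
  show "p' @ q' \<in> absorbed t"
    if "p @ q \<in> absorbed t" "p @ q' \<in> absorbed t" "p' @ q \<in> absorbed t" for p q p' q'
    using that by (rule absorbed_rectangle)
qed

end

end

section \<open>Evaluation in the semiring of a set of linear words\<close>

lemma sublist_factors: "u \<noteq> [] \<Longrightarrow> sublist u v \<Longrightarrow> v \<in> factors W \<Longrightarrow> u \<in> factors W"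
  by (auto simp: factors_def intro: sublist_order.order_trans)

lemma eval_carrier:
  "(\<And>x. \<rho> x \<in> carrier (word_semiring W)) \<Longrightarrow> eval (word_semiring W) \<rho> t \<in> carrier (word_semiring W)"
  using word_semiring_closed[of _ W]
  by (induction t) (auto simp: word_semiring_def)

lemma eval_subst: "eval A \<rho> (subst \<sigma> t) = eval A (\<lambda>x. eval A \<rho> (\<sigma> x)) t"
  by (induction t) auto

lemma derivable_sound:
  assumes "derivable E s t" "\<forall>e\<in>E. valid (word_semiring W) e"
  shows "valid (word_semiring W) (s, t)"
  using assms(1)
proof (induction rule: derivable.induct)
  case (ax s t \<sigma>)
  then show ?case using assms(2) eval_carrier[of _ W] by (fastforce simp: valid_def eval_subst)
qed (auto simp: valid_def)

section \<open>Nonzero values as solutions of word equations\<close>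

lemma word_mult_eq_Some:
  "word_mult W x y = Some w \<longleftrightarrow> (\<exists>u v. x = Some u \<and> y = Some v \<and> w = u @ v \<and> w \<in> factors W)"
  by (cases x; cases y) auto

lemma flat_add_eq_Some: "flat_add x y = Some w \<longleftrightarrow> x = Some w \<and> y = Some w"
  by (auto simp: flat_add_def)

lemma Nil_notin_factors: "[] \<notin> factors W"
  by (simp add: factors_def)

lemma eval_word_trm:
  assumes "\<And>x. \<rho> x \<in> carrier (word_semiring W)" "u \<noteq> []"
  shows "eval (word_semiring W) \<rho> (word_trm u) = Some w \<longleftrightarrow>
    (\<forall>x\<in>set u. \<rho> x \<noteq> None) \<and> w = concat (map (the \<circ> \<rho>) u) \<and> w \<in> factors W"
  using assms(2)
proof (induction u arbitrary: w rule: word_trm.induct)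
  case (2 x)
  then show ?case using assms(1)[of x] by (auto simp: word_semiring_def)
next
  case (3 x y u)
  have ne: "concat (map (the \<circ> \<rho>) (y # u)) \<noteq> []" if "\<rho> y \<noteq> None"
    using that assms(1)[of y] by (auto simp: word_semiring_def Nil_notin_factors)
  have "eval (word_semiring W) \<rho> (word_trm (x # y # u)) = Some w \<longleftrightarrow>
    (\<exists>a b. \<rho> x = Some a \<and> eval (word_semiring W) \<rho> (word_trm (y # u)) = Some b \<and>
      w = a @ b \<and> w \<in> factors W)"
    by (simp add: word_semiring_def word_mult_eq_Some)
  also have "\<dots> \<longleftrightarrow> (\<exists>a b. \<rho> x = Some a \<and> (\<forall>z\<in>set (y # u). \<rho> z \<noteq> None) \<and>
      b = concat (map (the \<circ> \<rho>) (y # u)) \<and> b \<in> factors W \<and> w = a @ b \<and> w \<in> factors W)"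
    unfolding "3.IH"[OF list.distinct(2)] by blast
  also have "\<dots> \<longleftrightarrow> (\<forall>z\<in>set (x # y # u). \<rho> z \<noteq> None) \<and>
      w = concat (map (the \<circ> \<rho>) (x # y # u)) \<and> w \<in> factors W"
    (is "?l \<longleftrightarrow> ?r")
  proof
    assume ?r
    moreover from this obtain a where "\<rho> x = Some a" by auto
    moreover have "concat (map (the \<circ> \<rho>) (y # u)) \<in> factors W"
      by (rule factors_append(2)[of a]) (use calculation ne in auto)
    ultimately show ?l by auto
  qed auto
  finally show ?case .
qed simp

text \<open>A flat sum is nonzero only if its summands agree, and products distribute over
  it.\<close>

lemma eval_words:
  assumes "\<And>x. \<rho> x \<in> carrier (word_semiring W)"
  shows "eval (word_semiring W) \<rho> t = Some w \<longleftrightarrow>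
    (\<forall>u\<in>words t. eval (word_semiring W) \<rho> (word_trm u) = Some w)"
proof (induction t arbitrary: w)
  case (Plus s t)
  have "eval (word_semiring W) \<rho> (Plus s t) = Some w \<longleftrightarrow>
      eval (word_semiring W) \<rho> s = Some w \<and> eval (word_semiring W) \<rho> t = Some w"
    by (simp add: word_semiring_def flat_add_eq_Some)
  then show ?case using Plus by auto
next
  case (Times s t)
  let ?e = "\<lambda>t. eval (word_semiring W) \<rho> t"
  have app: "?e (word_trm (u @ v)) = Some w \<longleftrightarrow>
      (\<exists>a b. ?e (word_trm u) = Some a \<and> ?e (word_trm v) = Some b \<and> w = a @ b \<and> w \<in> factors W)"
    if "u \<in> words s" "v \<in> words t" for u v w
  proof -
    have uv: "u \<noteq> []" "v \<noteq> []" "u @ v \<noteq> []" using that Nil_notin_words by auto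
    let ?c = "\<lambda>u. concat (map (the \<circ> \<rho>) u)" and ?d = "\<lambda>u. \<forall>x\<in>set u. \<rho> x \<noteq> None"
    have ne: "?c u \<noteq> []" if "u \<noteq> []" "?d u" for u
      using that assms[of "hd u"] by (cases u) (auto simp: word_semiring_def Nil_notin_factors)
    have fac: "?c u \<in> factors W \<and> ?c v \<in> factors W"
      if "?c u @ ?c v \<in> factors W" "?d u" "?d v"
      using factors_append[OF that(1)] ne uv that by blast
    have "?e (word_trm (u @ v)) = Some w \<longleftrightarrow> ?d u \<and> ?d v \<and> w = ?c u @ ?c v \<and> w \<in> factors W"
      unfolding eval_word_trm[OF assms uv(3)] by auto
    then show ?thesis
      unfolding eval_word_trm[OF assms uv(1)] eval_word_trm[OF assms uv(2)] using fac by blast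
  qed
  have times: "?e (Times s t) = Some w \<longleftrightarrow>
      (\<exists>a b. ?e s = Some a \<and> ?e t = Some b \<and> w = a @ b \<and> w \<in> factors W)"
    by (simp add: word_semiring_def word_mult_eq_Some)
  show ?case
  proof
    assume "?e (Times s t) = Some w"
    then obtain a b where ab: "?e s = Some a" "?e t = Some b" "w = a @ b" "w \<in> factors W"
      using times by blast
    show "\<forall>u\<in>words (Times s t). ?e (word_trm u) = Some w"
    proof
      fix u assume "u \<in> words (Times s t)"
      then obtain u1 u2 where u: "u = u1 @ u2" "u1 \<in> words s" "u2 \<in> words t" by auto
      then have "?e (word_trm u1) = Some a" "?e (word_trm u2) = Some b"
        using ab Times.IH by blast+
      then show "?e (word_trm u) = Some w" using app[OF u(2,3)] ab u(1) by simp
    qed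
  next
    assume all: "\<forall>u\<in>words (Times s t). ?e (word_trm u) = Some w"
    \<comment> \<open>Fixed words serve for comparison: the value of \<open>v0\<close> cancels from
      \<open>w\<close>, so all words of \<open>s\<close> share the value of \<open>u0\<close>, and
      likewise for \<open>t\<close>.\<close>
    obtain u0 v0 where 0: "u0 \<in> words s" "v0 \<in> words t" using words_nonempty by blast
    have split: "\<exists>a b. ?e (word_trm u) = Some a \<and> ?e (word_trm v) = Some b \<and> w = a @ b \<and> w \<in> factors W"
      if "u \<in> words s" "v \<in> words t" for u v
    proof -
      have "u @ v \<in> words (Times s t)" using that by auto
      then show ?thesis using all app[OF that, of w] by blast
    qed
    obtain a b where ab: "?e (word_trm u0) = Some a" "?e (word_trm v0) = Some b" "w = a @ b"
      "w \<in> factors W"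
      using split[OF 0] by blast
    have "?e (word_trm u) = Some a" if "u \<in> words s" for u using split[OF that 0(2)] ab by auto
    moreover have "?e (word_trm v) = Some b" if "v \<in> words t" for v
      using split[OF 0(1) that] ab by auto
    ultimately show "?e (Times s t) = Some w" using times ab Times.IH by blast
  qed
qed simp

lemma eval_Some_iff:
  assumes "\<And>x. \<rho> x \<in> carrier (word_semiring W)"
  shows "eval (word_semiring W) \<rho> t = Some w \<longleftrightarrow> w \<in> factors W \<and>
    (\<forall>u\<in>words t. (\<forall>x\<in>set u. \<rho> x \<noteq> None) \<and> concat (map (the \<circ> \<rho>) u) = w)"
proof -
  have "u \<noteq> []" if "u \<in> words t" for u using that Nil_notin_words by metis
  then have "eval (word_semiring W) \<rho> t = Some w \<longleftrightarrow>
      (\<forall>u\<in>words t. (\<forall>x\<in>set u. \<rho> x \<noteq> None) \<and> w = concat (map (the \<circ> \<rho>) u) \<and> w \<in> factors W)"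
    unfolding eval_words[OF assms, where t = t] by (intro ball_cong HOL.refl eval_word_trm assms)
  then show ?thesis using words_nonempty[of t] by (blast intro: HOL.sym)
qed

lemma valid_semiring_axioms:
  assumes "e \<in> semiring_axioms"
  shows "valid (word_semiring W) e"
proof -
  have "word_mult W (word_mult W (\<rho> 0) (\<rho> (Suc 0))) (\<rho> 2) =
      word_mult W (\<rho> 0) (word_mult W (\<rho> (Suc 0)) (\<rho> 2))"
    if "\<forall>x. \<rho> x \<in> carrier (word_semiring W)" for \<rho>
    using that by (intro word_mult_assoc) auto
  then show ?thesis
    using assms unfolding semiring_axioms_def valid_def
    by (auto simp: word_semiring_def flat_add_semilattice(1,3) word_mult_distrib
        intro: flat_add_semilattice(2))
qed

text \<open>The first letter of \<open>x\<close> occurs once in the linear word and fixes the place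
  of \<open>x\<close>. The validity of the zero identities and of the first exchange identity rests
  on this.\<close>

lemma distinct_segment_unique:
  assumes "distinct (p @ x @ q)" "p @ x @ q = p' @ x @ q'" "x \<noteq> []"
  shows "p = p'" "q = q'"
proof -
  obtain c y where x: "x = c # y" using assms(3) by (cases x) auto
  have "c \<notin> set p" "c \<notin> set (y @ q)" using assms(1) by (auto simp: x)
  moreover have "p @ c # (y @ q) = p' @ c # (y @ q')" using assms(2) by (simp add: x)
  ultimately have "p = p' \<and> y @ q = y @ q'" using append_Cons_eq_iff by metis
  then show "p = p'" "q = q'" by auto
qed

locale linear_words =
  fixes W :: "'a list set"
  assumes nonempty: "W \<noteq> {}"
    and no_empty_word: "w \<in> W \<Longrightarrow> w \<noteq> []"
    and linear: "w \<in> W \<Longrightarrow> distinct w"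
begin

section \<open>Validity of the basis\<close>

lemma factors_distinct: "u \<in> factors W \<Longrightarrow> distinct u"
  by (auto simp: factors_def sublist_def dest!: linear)

lemma eval_zero_trm:
  assumes "\<And>x. \<rho> x \<in> carrier (word_semiring W)"
  shows "eval (word_semiring W) \<rho> zero_trm = None"
proof -
  have "w @ w \<notin> factors W" for w
    using factors_distinct[of "w @ w"] Nil_notin_factors[of W] by auto
  then show ?thesis
    using assms[of 0] by (auto simp: word_semiring_def Nil_notin_factors)
qed

text \<open>Reduces validity of an identity to a question about solutions of word equations in
  nonempty words.\<close>

lemma eval_words_solution:
  assumes "\<And>x. \<rho> x \<in> carrier (word_semiring W)" "eval (word_semiring W) \<rho> t = Some w"
  obtains g where "\<And>x. g x \<noteq> []" "\<And>u. u \<in> words t \<Longrightarrow> concat (map g u) = w"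
    "\<And>u. \<lbrakk>u \<noteq> []; set u \<subseteq> \<Union> (set ` words t)\<rbrakk> \<Longrightarrow>
      eval (word_semiring W) \<rho> (word_trm u) = Some w \<longleftrightarrow> concat (map g u) = w"
    "w \<in> factors W"
proof
  \<comment> \<open>The default only keeps \<open>g\<close> free of empty words; the variables in
    the words of \<open>t\<close> have nonzero values.\<close>
  define g where "g x = (if \<rho> x = None then [undefined] else the (\<rho> x))" for x
  have *: "w \<in> factors W" "\<And>u. u \<in> words t \<Longrightarrow> \<forall>x\<in>set u. \<rho> x \<noteq> None"
    "\<And>u. u \<in> words t \<Longrightarrow> concat (map (the \<circ> \<rho>) u) = w"
    using assms(2) unfolding eval_Some_iff[OF assms(1)] by auto
  have g: "map g u = map (the \<circ> \<rho>) u" if "\<forall>x\<in>set u. \<rho> x \<noteq> None" for u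
    using that by (auto simp: g_def)
  show "w \<in> factors W" by (rule *)
  show "g x \<noteq> []" for x
    using assms(1)[of x] by (auto simp: g_def word_semiring_def Nil_notin_factors)
  show "concat (map g u) = w" if "u \<in> words t" for u
    using *(3)[OF that] unfolding g[OF *(2)[OF that]] .
  show "eval (word_semiring W) \<rho> (word_trm u) = Some w \<longleftrightarrow> concat (map g u) = w"
    if "u \<noteq> []" "set u \<subseteq> \<Union> (set ` words t)" for u
  proof -
    have dom: "\<forall>x\<in>set u. \<rho> x \<noteq> None" using that(2) *(2) by blast
    show ?thesis
      unfolding g[OF dom] eval_word_trm[OF assms(1) that(1)] using dom *(1) by auto
  qed
qed

lemma valid_zeroI:
  assumes "\<And>g w. \<lbrakk>w \<in> factors W; distinct w; \<And>x. g x \<noteq> []; \<And>u. u \<in> words t \<Longrightarrow> concat (map g u) = w\<rbrakk>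
      \<Longrightarrow> False"
  shows "valid (word_semiring W) (t, zero_trm)"
  unfolding valid_def
proof (intro allI impI)
  fix \<rho> :: "nat \<Rightarrow> 'a list option" assume "\<forall>x. \<rho> x \<in> carrier (word_semiring W)"
  then have \<rho>: "\<And>x. \<rho> x \<in> carrier (word_semiring W)" by blast
  have "eval (word_semiring W) \<rho> t = None"
  proof (rule ccontr)
    assume "eval (word_semiring W) \<rho> t \<noteq> None"
    then obtain w where "eval (word_semiring W) \<rho> t = Some w" by blast
    from eval_words_solution[OF \<rho> this] show False
      using assms factors_distinct by metis
  qed
  then show "eval (word_semiring W) \<rho> (fst (t, zero_trm)) = eval (word_semiring W) \<rho> (snd (t, zero_trm))"
    using eval_zero_trm[of \<rho>, OF \<rho>] by simp
qed

lemma valid_exchangeI: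
  assumes "u \<noteq> []" "set u \<subseteq> \<Union> (set ` words t)"
    and "\<And>g w. \<lbrakk>w \<in> factors W; distinct w; \<And>x. g x \<noteq> []; \<And>u. u \<in> words t \<Longrightarrow> concat (map g u) = w\<rbrakk>
      \<Longrightarrow> concat (map g u) = w"
  shows "valid (word_semiring W) (Plus t (word_trm u), t)"
  unfolding valid_def
proof (intro allI impI)
  fix \<rho> :: "nat \<Rightarrow> 'a list option" assume "\<forall>x. \<rho> x \<in> carrier (word_semiring W)"
  then have \<rho>: "\<And>x. \<rho> x \<in> carrier (word_semiring W)" by blast
  have "eval (word_semiring W) \<rho> (word_trm u) = Some w"
    if "eval (word_semiring W) \<rho> t = Some w" for w
    by (rule eval_words_solution[OF \<rho> that]) (use assms factors_distinct in metis)
  then show "eval (word_semiring W) \<rho> (fst (Plus t (word_trm u), t)) =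
      eval (word_semiring W) \<rho> (snd (Plus t (word_trm u), t))"
    by (cases "eval (word_semiring W) \<rho> t")
      (auto simp: word_semiring_def flat_add_def)
qed

lemma valid_zero_axioms:
  assumes "e \<in> zero_axioms"
  shows "valid (word_semiring W) e"
proof -
  have "valid (word_semiring W) e"
    if "e \<in> {(Plus zero_trm (Var 1), zero_trm), (Times zero_trm (Var 1), zero_trm),
      (Times (Var 1) zero_trm, zero_trm)}"
    using that
    by (auto intro!: valid_zeroI)
  moreover have "valid (word_semiring W) (t, zero_trm)"
    if t: "t \<in> {word_trm [1, 1],
      word_trm [1, 2, 1],
      Plus (word_trm [1]) (word_trm [1, 2]),
      Plus (word_trm [1]) (word_trm [2, 1]),
      Plus (word_trm [1]) (word_trm [2, 1, 3]),
      Plus (word_trm [1, 2]) (word_trm [3, 1]),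
      Plus (word_trm [1, 2]) (word_trm [3, 1, 4]),
      Plus (word_trm [2, 1]) (word_trm [3, 1, 4])}" for t
  proof (rule valid_zeroI)
    fix g :: "nat \<Rightarrow> 'a list" and w
    assume w: "distinct w" and g: "\<And>x. g x \<noteq> []"
      and sol: "\<And>u. u \<in> words t \<Longrightarrow> concat (map g u) = w"
    have uniq: "p = p' \<and> q = q'"
      if "p @ g 1 @ q = w" "p' @ g 1 @ q' = w" for p q p' q'
      using distinct_segment_unique[of p "g 1" q p' q'] that w g by auto
    \<comment> \<open>Each pattern shows \<open>g 1\<close> at two places of \<open>w\<close>, which
      differ because the other segments are nonempty.\<close>
    have "(\<exists>p q p' q'. p @ g 1 @ q = w \<and> p' @ g 1 @ q' = w \<and> (p \<noteq> p' \<or> q \<noteq> q'))"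
      using t
    proof (elim insertE)
      assume "t = word_trm [1, 1]"
      then have "g 1 @ g 1 = w" using sol[of "[1, 1]"] by simp
      then have "[] @ g 1 @ g 1 = w" "g 1 @ g 1 @ [] = w" by simp_all
      then show ?thesis using g by metis
    next
      assume "t = word_trm [1, 2, 1]"
      then have "g 1 @ g 2 @ g 1 = w" using sol[of "[1, 2, 1]"] by simp
      then have "[] @ g 1 @ (g 2 @ g 1) = w" "(g 1 @ g 2) @ g 1 @ [] = w" by simp_all
      then show ?thesis using g by (metis append_is_Nil_conv)
    next
      assume "t = Plus (word_trm [1]) (word_trm [1, 2])"
      then have "[] @ g 1 @ [] = w" "[] @ g 1 @ g 2 = w" using sol[of "[1]"] sol[of "[1, 2]"] by simp_all
      then show ?thesis using g by metis
    next
      assume "t = Plus (word_trm [1]) (word_trm [2, 1])"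
      then have "[] @ g 1 @ [] = w" "g 2 @ g 1 @ [] = w" using sol[of "[1]"] sol[of "[2, 1]"] by simp_all
      then show ?thesis using g by metis
    next
      assume "t = Plus (word_trm [1]) (word_trm [2, 1, 3])"
      then have "[] @ g 1 @ [] = w" "g 2 @ g 1 @ g 3 = w" using sol[of "[1]"] sol[of "[2, 1, 3]"] by simp_all
      then show ?thesis using g by metis
    next
      assume "t = Plus (word_trm [1, 2]) (word_trm [3, 1])"
      then have "[] @ g 1 @ g 2 = w" "g 3 @ g 1 @ [] = w" using sol[of "[1, 2]"] sol[of "[3, 1]"] by simp_all
      then show ?thesis using g by metis
    next
      assume "t = Plus (word_trm [1, 2]) (word_trm [3, 1, 4])"
      then have "[] @ g 1 @ g 2 = w" "g 3 @ g 1 @ g 4 = w" using sol[of "[1, 2]"] sol[of "[3, 1, 4]"] by simp_all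
      then show ?thesis using g by metis
    next
      assume "t = Plus (word_trm [2, 1]) (word_trm [3, 1, 4])"
      then have "g 2 @ g 1 @ [] = w" "g 3 @ g 1 @ g 4 = w" using sol[of "[2, 1]"] sol[of "[3, 1, 4]"] by simp_all
      then show ?thesis using g by metis
    qed simp
    then show False using uniq by blast
  qed
  ultimately show ?thesis using assms by (auto simp only: zero_axioms_def Un_iff image_iff)
qed

lemma valid_exchange_axioms:
  assumes "e \<in> exchange_axioms"
  shows "valid (word_semiring W) e"
proof -
  have "valid (word_semiring W)
    (Plus (Plus (word_trm [1, 0, 2]) (word_trm [3, 0, 4])) (word_trm [1, 0, 4]),
     Plus (word_trm [1, 0, 2]) (word_trm [3, 0, 4]))"
  proof (rule valid_exchangeI)
    fix g :: "nat \<Rightarrow> 'a list" and w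
    assume w: "distinct w" "\<And>x. g x \<noteq> []"
      and *: "\<And>u. u \<in> words (Plus (word_trm [1, 0, 2]) (word_trm [3, 0, 4])) \<Longrightarrow> concat (map g u) = w"
    have "g 1 @ g 0 @ g 2 = w" "g 3 @ g 0 @ g 4 = w"
      using *[of "[1, 0, 2]"] *[of "[3, 0, 4]"] by simp_all
    moreover from this have "g 1 = g 3"
      using distinct_segment_unique(1)[of "g 1" "g 0" "g 2" "g 3" "g 4"] w by simp
    ultimately show "concat (map g [1, 0, 4]) = w" by simp
  qed auto
  moreover have "valid (word_semiring W)
    (Plus (Plus (word_trm [0, 2]) (Plus (word_trm [0, 3]) (word_trm [1, 2]))) (word_trm [1, 3]),
     Plus (word_trm [0, 2]) (Plus (word_trm [0, 3]) (word_trm [1, 2])))"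
  proof (rule valid_exchangeI)
    fix g :: "nat \<Rightarrow> 'a list" and w
    assume *: "\<And>u. u \<in> words (Plus (word_trm [0, 2]) (Plus (word_trm [0, 3]) (word_trm [1, 2])))
        \<Longrightarrow> concat (map g u) = w"
    have "g 0 @ g 2 = w" "g 0 @ g 3 = w" "g 1 @ g 2 = w"
      using *[of "[0, 2]"] *[of "[0, 3]"] *[of "[1, 2]"] by simp_all
    moreover from this have "g 2 = g 3" using same_append_eq by metis
    ultimately show "concat (map g [1, 3]) = w" by simp
  qed auto
  ultimately show ?thesis using assms by (auto simp only: exchange_axioms_def image_iff split_conv)
qed

definition lens :: "nat set" where
  "lens = length ` factors W"

text \<open>Prefixes of factors are factors, so \<open>lens\<close> is a finite or infinite initial
  segment of the positive integers.\<close>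

lemma lens_down: "n \<in> lens \<Longrightarrow> 0 < m \<Longrightarrow> m \<le> n \<Longrightarrow> m \<in> lens"
proof -
  assume "n \<in> lens" "0 < m" "m \<le> n"
  then obtain u where u: "u \<in> factors W" "length u = n" by (auto simp: lens_def)
  have "take m u \<in> factors W"
    by (rule sublist_factors[OF _ sublist_take u(1)]) (use u \<open>0 < m\<close> \<open>m \<le> n\<close> in auto)
  moreover have "length (take m u) = m" using u \<open>m \<le> n\<close> by simp
  ultimately show "m \<in> lens" unfolding lens_def by (metis imageI)
qed

lemma one_lens: "1 \<in> lens"
proof -
  obtain w where "w \<in> W" using nonempty by blast
  then have "w \<in> factors W" using no_empty_word by (auto simp: factors_def)
  then have "length w \<in> lens" by (simp add: lens_def)
  then show ?thesis
    using lens_down[of "length w" 1] no_empty_word[OF \<open>w \<in> W\<close>] by (cases w) auto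
qed

lemma length_concat_le: "(\<And>x. g x \<noteq> []) \<Longrightarrow> length u \<le> length (concat (map g u))"
proof (induction u)
  case (Cons x u)
  then show ?case by (cases "g x") (auto simp: le_SucI trans_le_add2)
qed simp

lemma valid_long_axiom:
  assumes "Suc m \<notin> lens"
  shows "valid (word_semiring W) (long_axiom m)"
  unfolding long_axiom_def
proof (rule valid_zeroI)
  fix g :: "nat \<Rightarrow> 'a list" and w
  assume w: "w \<in> factors W" and g: "\<And>x. g x \<noteq> []"
    and *: "\<And>u. u \<in> words (word_trm [0..<Suc m]) \<Longrightarrow> concat (map g u) = w"
  have "[0..<Suc m] \<in> words (word_trm [0..<Suc m])" by (subst words_word_trm) auto
  then have "concat (map g [0..<Suc m]) = w" by (rule *)
  then have "Suc m \<le> length w" using length_concat_le[of g "[0..<Suc m]"] g by (auto simp del: upt_Suc)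
  moreover have "length w \<in> lens" using w by (simp add: lens_def)
  ultimately show False using assms lens_down by blast
qed

lemma concat_singletons:
  assumes "\<And>x. g x \<noteq> []" "length (concat (map g u)) \<le> length u"
  shows "\<forall>x\<in>set u. length (g x) = 1"
  using assms(2)
proof (induction u)
  case (Cons x u)
  have "length u \<le> length (concat (map g u))" using length_concat_le assms(1) by metis
  moreover have "0 < length (g x)" using assms(1) by simp
  moreover have "length (g x) + length (concat (map g u)) \<le> Suc (length u)"
    using Cons.prems by simp
  ultimately have "length (g x) = 1" "length (concat (map g u)) \<le> length u"
    by linarith+
  then show ?case using Cons.IH by simp
qed simp

lemma length_concat_singletons: "\<forall>x\<in>set u. length (g x) = 1 \<Longrightarrow> length (concat (map g u)) = length u"
  by (induction u) auto

lemma valid_cross_axiom: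
  assumes "m \<in> lens" "Suc m \<notin> lens" "i \<le> m"
  shows "valid (word_semiring W) (cross_axiom m i)"
  unfolding cross_axiom_def Let_def
proof (rule valid_exchangeI)
  have m: "0 < m" using assms(1) by (auto simp: lens_def Nil_notin_factors)
  have words: "words (Plus (word_trm [0..<m]) (word_trm [m..<m + m])) = {[0..<m], [m..<m + m]}"
    using m by (simp add: words_word_trm insert_commute)
  show "[0..<i] @ [m + i..<m + m] \<noteq> []" using m assms(3) by auto
  show "set ([0..<i] @ [m + i..<m + m])
      \<subseteq> \<Union> (set ` words (Plus (word_trm [0..<m]) (word_trm [m..<m + m])))"
    unfolding words using assms(3) by auto
  fix g :: "nat \<Rightarrow> 'a list" and w
  assume w: "w \<in> factors W" and g: "\<And>x. g x \<noteq> []"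
    and *: "\<And>u. u \<in> words (Plus (word_trm [0..<m]) (word_trm [m..<m + m])) \<Longrightarrow> concat (map g u) = w"
  have uv: "concat (map g [0..<m]) = w" "concat (map g [m..<m + m]) = w"
    using * unfolding words by auto
  have "length w \<in> lens" using w by (simp add: lens_def)
  then have "length w \<le> m" using lens_down[of "length w" "Suc m"] assms(2) by linarith
  \<comment> \<open>The \<open>m\<close> nonempty values fill a word of length at most
    \<open>m\<close>, so each is a single letter.\<close>
  then have single: "length (g x) = 1" if "x < m + m" for x
    using concat_singletons[of g "[0..<m]"] concat_singletons[of g "[m..<m + m]"] uv g that
    by (cases "x < m") auto
  have split: "[0..<m] = [0..<i] @ [i..<m]" "[m..<m + m] = [m..<m + i] @ [m + i..<m + m]"
    using assms(3) upt_add_eq_append[of 0 i "m - i"] upt_add_eq_append[of m "m + i" "m - i"]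
    by auto
  have eq: "concat (map g [0..<i]) @ concat (map g [i..<m]) = w"
    "concat (map g [m..<m + i]) @ concat (map g [m + i..<m + m]) = w"
    using uv unfolding split map_append concat_append by auto
  have "length (concat (map g [0..<i])) = length (concat (map g [m..<m + i]))"
    using single assms(3) by (subst (1 2) length_concat_singletons) auto
  then have "concat (map g [0..<i]) = concat (map g [m..<m + i])"
    using eq append_eq_append_conv by metis
  then show "concat (map g ([0..<i] @ [m + i..<m + m])) = w" using eq by simp
qed

text \<open>The index set is empty if the lengths are unbounded, and otherwise consists of the
  maximal length alone.\<close>

definition basis :: "identity set" where
  "basis = base_axioms \<union>
    (\<Union>m\<in>{m \<in> lens. Suc m \<notin> lens}. insert (long_axiom m) (cross_axiom m ` {..m}))"

lemma finite_basis: "finite basis"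
proof -
  have "a = b" if "a \<in> lens" "Suc a \<notin> lens" "b \<in> lens" "Suc b \<notin> lens" for a b
    using lens_down[of a "Suc b"] lens_down[of b "Suc a"] that
    by (cases a b rule: linorder_cases) auto
  then have "\<exists>b. {m \<in> lens. Suc m \<notin> lens} \<subseteq> {b}" by blast
  then have "finite {m \<in> lens. Suc m \<notin> lens}" using finite_subset by blast
  then show ?thesis
    by (auto simp: basis_def base_axioms_def semiring_axioms_def zero_axioms_def exchange_axioms_def)
qed

lemma valid_basis: "\<forall>e\<in>basis. valid (word_semiring W) e"
  using valid_semiring_axioms valid_zero_axioms valid_exchange_axioms valid_long_axiom
    valid_cross_axiom
  by (auto simp: basis_def base_axioms_def)

end

section \<open>Completeness of the basis\<close>

sublocale linear_words \<subseteq> bounded_word_theory basis lens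
  by unfold_locales (use one_lens in \<open>auto simp: basis_def\<close>)

context linear_words
begin

notation eqv (infix "\<approx>" 50) and below (infix "\<sqsubseteq>" 50)

lemma basis_sound: "s \<approx> t \<Longrightarrow> valid (word_semiring W) (s, t)"
  using derivable_sound valid_basis by blast

text \<open>Gives each letter its segment of a factor \<open>w\<close> of length \<open>N\<close>.
  The last property is what allows \<open>refuting_labelling\<close> to exclude the value
  \<open>w\<close> for a word.\<close>

lemma labelling_assignment:
  assumes "\<not> s \<approx> zero_trm" "closed_language.labelling (absorbed s) lens f N"
  obtains \<rho> w where "\<And>x. \<rho> x \<in> carrier (word_semiring W)"
    "eval (word_semiring W) \<rho> s = Some w" "length w = N" "distinct w"
    "\<And>u. \<lbrakk>u \<noteq> []; eval (word_semiring W) \<rho> (word_trm u) = Some w\<rbrakk> \<Longrightarrow>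
      set u \<subseteq> \<Union> (set ` absorbed s) \<and>
      concat (map (closed_language.segment (absorbed s) f w) u) = w"
proof -
  interpret L: closed_language "absorbed s" lens by (rule closed_absorbed[OF assms(1)])
  have "N \<in> lens" using L.labelling_lens assms(2) .
  then obtain w where w: "w \<in> factors W" "length w = N" by (auto simp: lens_def)
  let ?X = "\<Union> (set ` absorbed s)"
  \<comment> \<open>All other letters are sent to 0, so a word containing one cannot have value
    \<open>w\<close>.\<close>
  define \<rho> where "\<rho> x = (if x \<in> ?X then Some (L.segment f w x) else None)" for x
  have "L.segment f w x \<in> factors W" if "x \<in> ?X" for x
  proof -
    obtain p q where pq: "p @ x # q \<in> absorbed s" using \<open>x \<in> ?X\<close> by (auto dest: split_list)
    have "sublist (L.segment f w x) (drop (f p) w)"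
      unfolding L.segment_eq[OF assms(2) pq] by (rule sublist_take)
    then have "sublist (L.segment f w x) w"
      using sublist_drop sublist_order.order_trans by blast
    then show ?thesis
      using sublist_factors L.segment_nonempty[OF assms(2) w(2) pq] w(1) by blast
  qed
  then have \<rho>: "\<rho> x \<in> carrier (word_semiring W)" for x
    by (auto simp: \<rho>_def word_semiring_def)
  have segments: "map (the \<circ> \<rho>) u = map (L.segment f w) u" if "set u \<subseteq> ?X" for u
    using that by (auto simp: \<rho>_def)
  have dom: "(\<forall>x\<in>set u. \<rho> x \<noteq> None) \<longleftrightarrow> set u \<subseteq> ?X" for u
    by (auto simp: \<rho>_def)
  have "eval (word_semiring W) \<rho> s = Some w"
    unfolding eval_Some_iff[where \<rho> = \<rho>, OF \<rho>]
  proof (intro conjI ballI w(1))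
    fix u assume "u \<in> words s"
    then have u: "u \<in> absorbed s" using words_absorbed by blast
    then have "set u \<subseteq> ?X" by blast
    then show "\<rho> x \<noteq> None" if "x \<in> set u" for x using dom that by blast
    show "concat (map (the \<circ> \<rho>) u) = w"
      unfolding segments[OF \<open>set u \<subseteq> ?X\<close>] using L.concat_segments_word[OF assms(2) w(2) u] .
  qed
  moreover have "set u \<subseteq> ?X \<and> concat (map (L.segment f w) u) = w"
    if "u \<noteq> []" "eval (word_semiring W) \<rho> (word_trm u) = Some w" for u
  proof -
    have u: "set u \<subseteq> ?X" and "w = concat (map (the \<circ> \<rho>) u)"
      using that(2) dom unfolding eval_word_trm[where \<rho> = \<rho>, OF \<rho> that(1)] by blast+
    from HOL.sym[OF this(2)] show ?thesis unfolding segments[OF u] using u by blast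
  qed
  ultimately show ?thesis
    using w(2) factors_distinct[OF w(1)] by (intro that[of \<rho> w] \<rho>) simp_all
qed

text \<open>Any labelling gives an assignment under which \<open>s\<close>, hence \<open>t\<close>,
  is nonzero, whereas \<open>zero_trm\<close> always evaluates to 0.\<close>

lemma nonzero_transfer:
  assumes "valid (word_semiring W) (s, t)" "\<not> s \<approx> zero_trm"
  shows "\<not> t \<approx> zero_trm"
proof
  assume "t \<approx> zero_trm"
  interpret L: closed_language "absorbed s" lens by (rule closed_absorbed[OF assms(2)])
  obtain f N where "L.labelling f N" using L.exists_labelling by blast
  from labelling_assignment[OF assms(2) this] obtain \<rho> w where
    \<rho>: "\<And>x. \<rho> x \<in> carrier (word_semiring W)" and "eval (word_semiring W) \<rho> s = Some w"
    by metis
  then have "eval (word_semiring W) \<rho> t = Some w" using assms(1) by (simp add: valid_def)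
  moreover have "eval (word_semiring W) \<rho> t = eval (word_semiring W) \<rho> zero_trm"
    using basis_sound[OF \<open>t \<approx> zero_trm\<close>] \<rho> by (simp add: valid_def)
  ultimately show False using eval_zero_trm[of \<rho>, OF \<rho>] by simp
qed

lemma valid_below:
  assumes "valid (word_semiring W) (s, t)" "\<not> s \<approx> zero_trm"
  shows "t \<sqsubseteq> s"
proof (rule below_of_words, rule ccontr)
  fix u assume u: "u \<in> words t" and "\<not> word_trm u \<sqsubseteq> s"
  then have "u \<noteq> []" "u \<notin> absorbed s" using Nil_notin_words by (auto simp: absorbed_def)
  interpret L: closed_language "absorbed s" lens by (rule closed_absorbed[OF assms(2)])
  \<comment> \<open>If \<open>u\<close> has a letter foreign to \<open>absorbed s\<close>, any
    labelling serves; otherwise one refuting \<open>u\<close> is taken. The premise on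
    \<open>set u\<close> merges both cases.\<close>
  obtain f N where f: "L.labelling f N"
    and outside: "\<And>w :: 'a list. \<lbrakk>set u \<subseteq> \<Union> (set ` absorbed s); length w = N; distinct w\<rbrakk> \<Longrightarrow>
      concat (map (L.segment f w) u) \<noteq> w"
    using L.refuting_labelling[OF \<open>u \<notin> absorbed s\<close>] L.exists_labelling by metis
  obtain \<rho> w where \<rho>: "\<And>x. \<rho> x \<in> carrier (word_semiring W)"
    and s: "eval (word_semiring W) \<rho> s = Some w" and w: "length w = N" "distinct w"
    and sol: "\<And>u. \<lbrakk>u \<noteq> []; eval (word_semiring W) \<rho> (word_trm u) = Some w\<rbrakk> \<Longrightarrow>
      set u \<subseteq> \<Union> (set ` absorbed s) \<and> concat (map (L.segment f w) u) = w"
    using labelling_assignment[OF assms(2) f] by metis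
  have "eval (word_semiring W) \<rho> t = Some w" using assms(1) \<rho> s by (simp add: valid_def)
  then have "eval (word_semiring W) \<rho> (word_trm u) = Some w"
    using eval_words[where \<rho> = \<rho>, OF \<rho>, of t w] u by blast
  then show False using sol[OF \<open>u \<noteq> []\<close>] outside w by blast
qed

lemma valid_derivable:
  assumes "valid (word_semiring W) (s, t)"
  shows "s \<approx> t"
proof -
  have sym: "valid (word_semiring W) (t, s)" using assms by (simp add: valid_def)
  show ?thesis
  proof (cases "s \<approx> zero_trm")
    case True
    then have "t \<approx> zero_trm" using nonzero_transfer[OF sym] by blast
    then show ?thesis using True eqv_trans eqv_sym by blast
  next
    case False
    then have "\<not> t \<approx> zero_trm" using nonzero_transfer[OF assms] by blast
    then show ?thesis using below_antisym valid_below[OF assms False] valid_below[OF sym] by blast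
  qed
qed

end

theorem theorem1p1:
  fixes W :: "'a list set"
  assumes "W \<noteq> {}"
    and "\<And>w. w \<in> W \<Longrightarrow> w \<noteq> []"
    and "\<And>w. w \<in> W \<Longrightarrow> distinct w"
  shows "finitely_based (word_semiring W)"
proof -
  interpret linear_words W using assms by unfold_locales
  show ?thesis
    unfolding finitely_based_def using finite_basis valid_basis valid_derivable by blast
qed

end
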